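(* Let $w_0$ be a non-negative function on $[0,\infty)$ and, in each dimension, set $w(x)=w_0(|x|)$. Suppose that for some $m\in\mathbb N$ one has $w\in A_1(\mathbb R^m)$. Then $w\in A_1(\mathbb R^n)$ for all $n\ge m$, and $$[w]^{\ast}_{A_1(\mathbb R^n)}\le C_m\,\frac nm\,[w]^{\ast}_{A_1(\mathbb R^m)},$$ where $C_m$ is a constant depending only on $m$. The same holds for $(w)_{A_1}$, that is, $(w)_{A_1(\mathbb R^n)}\le C_m\,\frac nm\,(w)_{A_1(\mathbb R^m)}$ for all $n\ge m$, with $C_m$ depending only on $m$.
   Context: A weight on $\mathbb R^n$ is an a.e. nonnegative, locally integrable function. The centered Hardy–Littlewood maximal operator on $\mathbb R^n$ is $Mg(x)=\sup_{R>0}\frac{1}{|B_R(x)|}\int_{B_R(x)}|g(y)|\,dy$, where $B_R(x)$ is the Euclidean ball of radius $R$ centered at $x$. A weight $w$ belongs to $A_1(\mathbb R^n)$ if there is $C>0$ with $Mw(x)\le C\,w(x)$ for a.e. $x\in\mathbb R^n$; the smallest such $C$ is denoted $[w]^{\ast}_{A_1(\mathbb R^n)}$. Write $v_n(t)=t^{n-1}$ on $[0,\infty)$; for an interval $I\subset[0,\infty)$ put $v_n(I)=\int_I t^{n-1}\,dt$ and $w_0v_n(I)=\int_I w_0(t)t^{n-1}\,dt$. For a radial weight $w(x)=w_0(|x|)$ on $\mathbb R^n$, the constant $(w)_{A_1(\mathbb R^n)}$ is the smallest $C>0$ such that $$\frac{w_0v_n(I)}{v_n(I)}\le C\,\operatorname*{ess\,inf}_{t\in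 I}w_0(t)$$ for all bounded intervals $I\subset[0,\infty)$ of positive length. For a radial weight, $w\in A_1(\mathbb R^n)$ if and only if $(w)_{A_1(\mathbb R^n)}<\infty$. *)

theory Defs
  imports "HOL-Analysis.Analysis"
begin

text \<open>
  Because the dimension is quantified inside the theorem, \<open>\<real>\<^sup>n\<close> is not a type here: its points are
  the extensional functions on \<open>{..<n}\<close>, and its Euclidean norm is \<^const>\<open>L2_set\<close>. The completion
  makes measurability on \<open>\<real>\<^sup>n\<close> mean Lebesgue (rather than Borel) measurability.
\<close>

definition lebesgue_Rn :: "nat \<Rightarrow> (nat \<Rightarrow> real) measure" where
  "lebesgue_Rn n = completion (Pi\<^sub>M {..<n} (\<lambda>_. lborel))"

definition ball_Rn :: "nat \<Rightarrow> (nat \<Rightarrow> real) \<Rightarrow> real \<Rightarrow> (nat \<Rightarrow> real) set" where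
  "ball_Rn n x R = {y \<in> space (lebesgue_Rn n). L2_set (\<lambda>i. y i - x i) {..<n} < R}"

definition radial :: "nat \<Rightarrow> (real \<Rightarrow> real) \<Rightarrow> (nat \<Rightarrow> real) \<Rightarrow> real" where
  "radial n w0 x = w0 (L2_set x {..<n})"

definition locally_integrable_Rn :: "nat \<Rightarrow> ((nat \<Rightarrow> real) \<Rightarrow> real) \<Rightarrow> bool" where
  "locally_integrable_Rn n g \<longleftrightarrow>
     (\<forall>x\<in>space (lebesgue_Rn n). \<forall>R>0. set_integrable (lebesgue_Rn n) (ball_Rn n x R) g)"

definition weight :: "nat \<Rightarrow> ((nat \<Rightarrow> real) \<Rightarrow> real) \<Rightarrow> bool" where
  "weight n w \<longleftrightarrow> (AE x in lebesgue_Rn n. 0 \<le> w x) \<and> locally_integrable_Rn n w"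

definition maximal_op :: "nat \<Rightarrow> ((nat \<Rightarrow> real) \<Rightarrow> real) \<Rightarrow> (nat \<Rightarrow> real) \<Rightarrow> ennreal" where
  "maximal_op n g x =
     (SUP R\<in>{0<..}. (\<integral>\<^sup>+y\<in>ball_Rn n x R. ennreal \<bar>g y\<bar> \<partial>lebesgue_Rn n)
                     / emeasure (lebesgue_Rn n) (ball_Rn n x R))"

definition A1_bound :: "nat \<Rightarrow> ((nat \<Rightarrow> real) \<Rightarrow> real) \<Rightarrow> real \<Rightarrow> bool" where
  "A1_bound n w C \<longleftrightarrow> (AE x in lebesgue_Rn n. maximal_op n w x \<le> ennreal C * ennreal (w x))"

definition A1 :: "nat \<Rightarrow> ((nat \<Rightarrow> real) \<Rightarrow> real) set" where
  "A1 n = {w. weight n w \<and> (\<exists>C>0. A1_bound n w C)}"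

text \<open>
  Both constants below are infima in \<^typ>\<open>ennreal\<close>, hence \<open>\<infinity>\<close> if no \<open>C\<close> is admissible. The infimum
  is a minimum except for \<open>w = 0\<close> a.e., where every \<open>C > 0\<close> is admissible and the constant is \<open>0\<close>.
\<close>

definition A1_const :: "nat \<Rightarrow> ((nat \<Rightarrow> real) \<Rightarrow> real) \<Rightarrow> ennreal" where
  "A1_const n w = Inf {ennreal C | C. C > 0 \<and> A1_bound n w C}"

definition ess_inf_on :: "real set \<Rightarrow> (real \<Rightarrow> real) \<Rightarrow> ennreal" where
  "ess_inf_on I f = Sup {a. AE t in lebesgue. t \<in> I \<longrightarrow> a \<le> ennreal (f t)}"

text \<open>
  \<open>radial_mass n f I\<close> is the integral of \<open>f t * t ^ (n - 1)\<close> over \<open>I\<close>: it is \<open>v\<^sub>n(I)\<close> for \<open>f = 1\<close> and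
  \<open>w\<^sub>0v\<^sub>n(I)\<close> for \<open>f = w\<^sub>0\<close>. It is meant for \<open>n \<ge> 1\<close>.
\<close>

definition radial_mass :: "nat \<Rightarrow> (real \<Rightarrow> real) \<Rightarrow> real set \<Rightarrow> ennreal" where
  "radial_mass n f I = (\<integral>\<^sup>+t\<in>I. ennreal (f t * t ^ (n - 1)) \<partial>lebesgue)"

definition radial_A1_bound :: "nat \<Rightarrow> (real \<Rightarrow> real) \<Rightarrow> real \<Rightarrow> bool" where
  "radial_A1_bound n w0 C \<longleftrightarrow>
     (\<forall>I. is_interval I \<and> bounded I \<and> I \<subseteq> {0..} \<and> 0 < measure lebesgue I \<longrightarrow>
        radial_mass n w0 I / radial_mass n (\<lambda>_. 1) I \<le> ennreal C * ess_inf_on I w0)"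

definition radial_A1_const :: "nat \<Rightarrow> (real \<Rightarrow> real) \<Rightarrow> ennreal" where
  "radial_A1_const n w0 = Inf {ennreal C | C. C > 0 \<and> radial_A1_bound n w0 C}"

end

theory Submission
  imports Defs
begin

text \<open>
  Let \<open>\<rho> = |x|\<close>, and let \<open>Av\<close> denote the average of \<open>w\<^sub>0(|y|)\<close> over \<open>y \<in> B\<^sub>R(x)\<close>. Everything rests on
  comparing the average over \<open>B\<^sub>R(x)\<close> in \<open>\<real>\<^sup>n\<close> with averages over balls of comparable radius, centred
  at distance \<open>\<rho>\<close> from the origin, in \<open>\<real>\<^sup>m\<close>, at the cost of one factor \<open>n\<close>
  (\<open>ball_integral_dimension_transfer\<close>). If \<open>y\<close> is uniformly distributed in \<open>B\<^sub>R(x)\<close>, the density of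
  \<open>|y|\<close> on the half-line is at most \<open>n/R\<close>: the part of a sphere around the origin inside \<open>B\<^sub>R(x)\<close> has no
  more area than the boundary of \<open>B\<^sub>R(x)\<close>, which is \<open>n/R\<close> times its volume. (A weaker bound, a constant
  times \<open>n max(1, \<rho>/R) / r\<close> at \<open>r\<close>, is enough and easier to obtain.) The density is also at most
  \<open>n r\<^sup>n\<^sup>-\<^sup>1 / R\<^sup>n\<close>, by polar coordinates.

  For \<open>R \<le> \<rho>/2\<close> the first bound gives \<open>Av \<lesssim> (n/R) \<integral> w\<^sub>0\<close> over \<open>[\<rho> - R, \<rho> + R]\<close>, and in the fixed
  dimension \<open>m\<close> this integral is in turn at most \<open>C\<^sub>m R\<close> times an average over a ball of radius
  \<open>7 R\<close>. For \<open>R > \<rho>/2\<close> the two bounds give \<open>Av \<lesssim> n R\<^sup>-\<^sup>m \<integral> w\<^sub>0(t) t\<^sup>m\<^sup>-\<^sup>1 dt\<close> over \<open>[0, 3 R]\<close>, which is an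
  integral over a ball around the origin of \<open>\<real>\<^sup>m\<close>, contained in the ball of radius \<open>5 R\<close> around any
  point at distance \<open>\<rho>\<close>.

  Surface measure is avoided by averaging over dilations. Integrating \<open>w\<^sub>0(s|y|)\<close> over \<open>y\<close> in a ball
  and \<open>s\<close> in a short interval, one order of integration gives integrals of \<open>w\<^sub>0\<close> over dilated balls,
  the other gives integrals of \<open>w\<^sub>0\<close> over intervals. With dilation factors in \<open>[1, 1 + \<epsilon>]\<close>,
  \<open>\<epsilon> \<le> 1/n\<close>, the volume changes only by a factor \<open>e\<close>, which yields the density bound
  (\<open>ball_integral_le_radial_integral\<close>); with factors that sweep \<open>|y|\<close> across
  \<open>[\<rho> - R, \<rho> + R]\<close>, it yields the converse estimate (\<open>interval_integral_le_ball_integral\<close>). The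
  same device shows that a property of \<open>|x|\<close> that holds for almost every \<open>x \<in> \<real>\<^sup>m\<close> holds for almost every
  radius (\<open>AE_nrmD\<close>), hence for almost every \<open>x \<in> \<real>\<^sup>n\<close>, and that \<open>w\<^sub>0\<close> agrees almost everywhere
  with a Borel function (\<open>radial_borel_representative\<close>).

  The constants over intervals need no geometry: on \<open>I = [a, b]\<close> one has
  \<open>t\<^sup>n\<^sup>-\<^sup>1 \<le> b\<^sup>n\<^sup>-\<^sup>m t\<^sup>m\<^sup>-\<^sup>1\<close> and \<open>b\<^sup>n\<^sup>-\<^sup>m (b\<^sup>m - a\<^sup>m) \<le> b\<^sup>n - a\<^sup>n\<close>, which gives the factor \<open>n/m\<close> exactly.
\<close>

section \<open>Scaling inequalities in the extended nonnegative reals\<close>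

lemma ennreal_cmult_le_imp_le:
  fixes X Y :: ennreal
  assumes c: "0 < c" and le: "ennreal c * X \<le> Y"
  shows "X \<le> ennreal (1 / c) * Y"
proof -
  have "ennreal (1 / c) * (ennreal c * X) \<le> ennreal (1 / c) * Y"
    using le by (rule mult_left_mono) simp
  also have "ennreal (1 / c) * (ennreal c * X) = X"
    using c by (simp add: mult.assoc[symmetric] ennreal_mult[symmetric])
  finally show ?thesis .
qed

lemma ennreal_divide_le_iff:
  fixes X K :: ennreal
  assumes "0 < v"
  shows "X / ennreal v \<le> K \<longleftrightarrow> X \<le> K * ennreal v"
proof
  have v: "ennreal v \<noteq> 0" "ennreal v < top" using assms by auto
  show "X \<le> K * ennreal v" if "X / ennreal v \<le> K"
  proof -
    have "X / ennreal v * ennreal v \<le> K * ennreal v"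
      using that by (rule mult_right_mono) simp
    then show ?thesis using v by (simp add: ennreal_divide_times)
  qed
  show "X / ennreal v \<le> K" if "X \<le> K * ennreal v"
  proof -
    have "X / ennreal v \<le> K * ennreal v / ennreal v"
      using that by (rule divide_right_mono_ennreal)
    then show ?thesis using v by (simp add: mult_divide_eq_ennreal)
  qed
qed

text \<open>
  Both constants of the theorem are infima of this shape, so bounds for the constants follow from
  bounds for the individual admissible \<open>C\<close>, including the cases of no admissible \<open>C\<close> and of infimum \<open>0\<close>.
\<close>

lemma Inf_ennreal_scale_le:
  assumes c: "0 < c" and PQ: "\<And>C. 0 < C \<Longrightarrow> P C \<Longrightarrow> Q (c * C)"
  shows "Inf {ennreal C | C. C > 0 \<and> Q C} \<le> ennreal c * Inf {ennreal C | C. C > 0 \<and> P C}"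
proof -
  let ?q = "Inf {ennreal C | C. C > 0 \<and> Q C}"
  have "ennreal (1 / c) * ?q \<le> Inf {ennreal C | C. C > 0 \<and> P C}"
  proof (rule Inf_greatest, clarify)
    fix C :: real assume C: "0 < C" "P C"
    have "?q \<le> ennreal (c * C)"
      using c C PQ by (intro Inf_lower) auto
    then have "ennreal (1 / c) * ?q \<le> ennreal (1 / c) * ennreal (c * C)"
      by (rule mult_left_mono) simp
    also have "\<dots> = ennreal C"
      using c C by (simp add: ennreal_mult[symmetric])
    finally show "ennreal (1 / c) * ?q \<le> ennreal C" .
  qed
  then show ?thesis
    using ennreal_cmult_le_imp_le[of "1 / c"] c by simp
qed

section \<open>Lebesgue measure on \<open>\<real>\<^sup>n\<close> in polar coordinates\<close>

abbreviation Rn :: "nat \<Rightarrow> (nat \<Rightarrow> real) measure" where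
  "Rn n \<equiv> Pi\<^sub>M {..<n} (\<lambda>_. lborel)"

abbreviation nrm :: "nat \<Rightarrow> (nat \<Rightarrow> real) \<Rightarrow> real" where
  "nrm n x \<equiv> L2_set x {..<n}"

abbreviation vol1 :: "nat \<Rightarrow> real" where
  "vol1 n \<equiv> unit_ball_vol (real n)"

lemma product_sigma_finite_lborel: "product_sigma_finite (\<lambda>_::nat. lborel :: real measure)"
  by (intro product_sigma_finite.intro lborel.sigma_finite_measure_axioms)

lemma sigma_finite_Rn: "sigma_finite_measure (Rn n)"
  by (intro product_sigma_finite.sigma_finite product_sigma_finite_lborel) simp

lemma measurable_nrm [measurable]: "nrm n \<in> borel_measurable (Rn n)"
  unfolding L2_set_def by measurable

lemma measurable_nrm_diff [measurable]: "(\<lambda>y. L2_set (\<lambda>i. y i - x i) {..<n}) \<in> borel_measurable (Rn n)"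
  unfolding L2_set_def by measurable

lemma space_lebesgue_Rn: "space (lebesgue_Rn n) = space (Rn n)"
  by (simp add: lebesgue_Rn_def)

lemma ball_Rn_sets [measurable]: "ball_Rn n x R \<in> sets (Rn n)"
  unfolding ball_Rn_def space_lebesgue_Rn by measurable

text \<open>
  Both sides define a measure with the same value on every box, by the one-dimensional affine
  substitution in each coordinate; a product measure is determined by its values on boxes.
\<close>

lemma nn_integral_Rn_affine:
  assumes g: "g \<in> borel_measurable (Rn n)" and s: "0 < s"
  shows "(\<integral>\<^sup>+y. g y \<partial>Rn n) = ennreal (s ^ n) * (\<integral>\<^sup>+y. g (\<lambda>i\<in>{..<n}. x i + s * y i) \<partial>Rn n)"
proof -
  interpret product_sigma_finite "\<lambda>_::nat. lborel :: real measure"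
    by (rule product_sigma_finite_lborel)
  let ?T = "\<lambda>y. \<lambda>i\<in>{..<n}. x i + s * y i"
  let ?D = "density (distr (Rn n) (Rn n) ?T) (\<lambda>_. ennreal (s ^ n))"
  have T [measurable]: "?T \<in> measurable (Rn n) (Rn n)"
    by measurable
  have "?D = Rn n"
  proof (rule PiM_eqI)
    fix A :: "nat \<Rightarrow> real set"
    assume A: "\<And>i. i \<in> {..<n} \<Longrightarrow> A i \<in> sets lborel"
    then have A' [measurable]: "Pi\<^sub>E {..<n} A \<in> sets (Rn n)"
      by (intro sets_PiM_I_finite) auto
    let ?B = "\<lambda>i. (\<lambda>t. x i + s * t) -` A i"
    have B: "?B i \<in> sets lborel" if "i \<in> {..<n}" for i
      using measurable_sets[of "\<lambda>t. x i + s * t" lborel lborel "A i"] A[OF that] by simp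
    have one: "ennreal s * emeasure lborel (?B i) = emeasure lborel (A i)" if "i \<in> {..<n}" for i
    proof -
      have "emeasure lborel (A i) = (\<integral>\<^sup>+t. indicator (A i) t \<partial>lborel)"
        using A[OF that] by simp
      also have "\<dots> = ennreal s * (\<integral>\<^sup>+t. indicator (A i) (x i + s * t) \<partial>lborel)"
        using A[OF that] s by (subst nn_integral_real_affine[where c = s and t = "x i"]) auto
      also have "(\<integral>\<^sup>+t. indicator (A i) (x i + s * t) \<partial>lborel) = (\<integral>\<^sup>+t. indicator (?B i) t \<partial>lborel)"
        by (intro nn_integral_cong) (auto split: split_indicator)
      also have "\<dots> = emeasure lborel (?B i)"
        using B[OF that] by simp
      finally show ?thesis by simp
    qed
    have "emeasure ?D (Pi\<^sub>E {..<n} A) = ennreal (s ^ n) * emeasure (distr (Rn n) (Rn n) ?T) (Pi\<^sub>E {..<n} A)"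
      by (subst emeasure_density) (auto simp: nn_integral_cmult_indicator)
    also have "emeasure (distr (Rn n) (Rn n) ?T) (Pi\<^sub>E {..<n} A) = emeasure (Rn n) (Pi\<^sub>E {..<n} ?B)"
      by (subst emeasure_distr) (auto intro!: arg_cong[where f = "emeasure (Rn n)"] simp: space_PiM PiE_iff extensional_def Pi_iff)
    also have "\<dots> = (\<Prod>i<n. emeasure lborel (?B i))"
      using B by (intro emeasure_PiM) auto
    also have "ennreal (s ^ n) * \<dots> = (\<Prod>i<n. ennreal s * emeasure lborel (?B i))"
      using s by (simp add: prod.distrib ennreal_power)
    also have "\<dots> = (\<Prod>i<n. emeasure lborel (A i))"
      using one by (intro prod.cong) auto
    finally show "emeasure ?D (Pi\<^sub>E {..<n} A) = (\<Prod>i<n. emeasure lborel (A i))" .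
  qed auto
  then have "(\<integral>\<^sup>+y. g y \<partial>Rn n) = (\<integral>\<^sup>+y. g y \<partial>?D)"
    by simp
  also have "\<dots> = ennreal (s ^ n) * (\<integral>\<^sup>+y. g (?T y) \<partial>Rn n)"
    using g by (subst nn_integral_density) (auto simp: nn_integral_cmult nn_integral_distr)
  finally show ?thesis .
qed

lemma nn_integral_power_Icc:
  fixes a b :: real
  assumes n: "1 \<le> n" and ab: "0 \<le> a" "a \<le> b"
  shows "(\<integral>\<^sup>+t\<in>{a..b}. ennreal (t ^ (n - 1)) \<partial>lborel) = ennreal ((b ^ n - a ^ n) / n)"
proof -
  have "(\<integral>\<^sup>+t\<in>{a..b}. ennreal (t ^ (n - 1)) \<partial>lborel) = ennreal (b ^ n / n - a ^ n / n)"
  proof (rule nn_integral_FTC_Icc)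
    show "((\<lambda>t. t ^ n / n) has_real_derivative t ^ (n - 1)) (at t)" for t
      by (rule derivative_eq_intros refl | use n in simp)+
  qed (use ab in auto)
  then show ?thesis by (simp add: diff_divide_distrib)
qed

lemma nrm_cball_volume:
  assumes "1 \<le> n" "0 \<le> r"
  shows "emeasure (Rn n) {y \<in> space (Rn n). nrm n y \<le> r} = ennreal (vol1 n * r ^ n)"
proof (cases "r = 0")
  case False
  then have "0 < r" using assms by simp
  have "{y \<in> space (Rn n). nrm n y \<le> r} = {f. sqrt (\<Sum>i\<in>{..<n}. (f i)\<^sup>2) \<le> r} \<inter> space (Rn n)"
    by (auto simp: L2_set_def)
  then show ?thesis
    using emeasure_cball_aux[of "{..<n}" r] \<open>0 < r\<close> by simp
next
  case True
  interpret product_sigma_finite "\<lambda>_::nat. lborel :: real measure"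
    by (rule product_sigma_finite_lborel)
  have le: "nrm n y \<le> 0 \<longleftrightarrow> (\<forall>i<n. y i = 0)" for y
    using L2_set_nonneg[of y "{..<n}"] L2_set_eq_0_iff[of "{..<n}" y] by (auto simp: order.antisym)
  have "{y \<in> space (Rn n). nrm n y \<le> r} = Pi\<^sub>E {..<n} (\<lambda>_. {0})"
    unfolding True by (auto simp: le space_PiM PiE_iff Pi_iff extensional_def fun_eq_iff)
  also have "emeasure (Rn n) \<dots> = (\<Prod>i<n. emeasure lborel {0::real})"
    by (rule emeasure_PiM) auto
  finally show ?thesis
    using assms True by (simp add: power_0_left)
qed

text \<open>
  Polar coordinates for radial functions: the image of Lebesgue measure under the norm gives
  \<open>[0, r]\<close> the mass \<open>vol1 n * r ^ n\<close>, and such intervals determine a Borel measure.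
\<close>

lemma distr_nrm:
  assumes n: "1 \<le> n"
  shows "distr (Rn n) borel (nrm n)
       = density lborel (\<lambda>t. ennreal (real n * vol1 n * t ^ (n - 1)) * indicator {0..} t)"
    (is "?M = ?N")
proof (rule measure_eqI_generator_eq)
  show "Int_stable (range (\<lambda>r::real. {..r}))"
    proof (rule Int_stableI)
    fix A B assume "A \<in> range (\<lambda>r::real. {..r})" "B \<in> range (\<lambda>r::real. {..r})"
    then obtain a b where "A = {..a}" "B = {..b}" by auto
    then have "A \<inter> B = {..min a b}" by auto
    then show "A \<inter> B \<in> range (\<lambda>r::real. {..r})" by blast
  qed
  show "range (\<lambda>r::real. {..r}) \<subseteq> Pow UNIV" by simp
  have gen: "sets borel = sigma_sets UNIV (range (\<lambda>r::real. {..r}))"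
    by (subst borel_eq_atMost) (simp add: atMost_def[symmetric])
  show "sets ?M = sigma_sets UNIV (range (\<lambda>r::real. {..r}))"
       "sets ?N = sigma_sets UNIV (range (\<lambda>r::real. {..r}))"
    using gen by simp_all
  have M: "emeasure ?M {..r} = (if r < 0 then 0 else ennreal (vol1 n * r ^ n))" for r
  proof -
    have "emeasure ?M {..r} = emeasure (Rn n) {y \<in> space (Rn n). nrm n y \<le> r}"
      by (subst emeasure_distr) (auto intro!: arg_cong[where f = "emeasure (Rn n)"])
    moreover have "{y \<in> space (Rn n). nrm n y \<le> r} = {}" if "r < 0"
    proof -
      have "\<not> nrm n y \<le> r" for y
        using L2_set_nonneg[of y "{..<n}"] that by linarith
      then show ?thesis by auto
    qed
    ultimately show ?thesis
      using nrm_cball_volume[OF n, of r] by (cases "r < 0") simp_all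
  qed
  show "emeasure ?M {..real i} \<noteq> \<infinity>" for i
    by (simp add: M)
  show "range (\<lambda>i. {..real i}) \<subseteq> range (\<lambda>r::real. {..r})" by auto
  show "(\<Union>i. {..real i}) = UNIV" using real_arch_simple by auto
  fix X assume "X \<in> range (\<lambda>r::real. {..r})"
  then obtain r where X: "X = {..r}" by auto
  have "emeasure ?N {..r} = (\<integral>\<^sup>+t. ennreal (real n * vol1 n * t ^ (n - 1)) * indicator {0..r} t \<partial>lborel)"
    by (subst emeasure_density) (auto intro!: nn_integral_cong split: split_indicator)
  also have "\<dots> = (if r < 0 then 0 else ennreal (vol1 n * r ^ n))"
  proof (cases "r < 0")
    case False
    have "(\<integral>\<^sup>+t. ennreal (real n * vol1 n * t ^ (n - 1)) * indicator {0..r} t \<partial>lborel)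
        = ennreal (vol1 n * r ^ n - vol1 n * 0 ^ n)"
    proof (rule nn_integral_FTC_Icc)
      show "((\<lambda>t. vol1 n * t ^ n) has_real_derivative real n * vol1 n * t ^ (n - 1)) (at t)" for t
        by (auto intro!: derivative_eq_intros)
    qed (use False in \<open>auto\<close>)
    then show ?thesis using False n by (simp add: power_0_left)
  qed auto
  finally show "emeasure ?M X = emeasure ?N X"
    by (simp add: X M)
qed

lemma nn_integral_nrm:
  assumes "1 \<le> n" and [measurable]: "f \<in> borel_measurable borel"
  shows "(\<integral>\<^sup>+y. f (nrm n y) \<partial>Rn n)
       = ennreal (real n * vol1 n) * (\<integral>\<^sup>+t\<in>{0..}. f t * ennreal (t ^ (n - 1)) \<partial>lborel)"
proof -
  have "(\<integral>\<^sup>+y. f (nrm n y) \<partial>Rn n) = (\<integral>\<^sup>+t. f t \<partial>distr (Rn n) borel (nrm n))"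
    by (subst nn_integral_distr) auto
  also have "\<dots> = (\<integral>\<^sup>+t. ennreal (real n * vol1 n) * (f t * ennreal (t ^ (n - 1)) * indicator {0..} t) \<partial>lborel)"
    unfolding distr_nrm[OF assms(1)]
    by (subst nn_integral_density) (auto intro!: nn_integral_cong simp: ennreal_mult ac_simps split: split_indicator)
  finally show ?thesis by (simp add: nn_integral_cmult)
qed

lemma emeasure_ball_Rn:
  assumes n: "1 \<le> n" and R: "0 < R"
  shows "emeasure (Rn n) (ball_Rn n x R) = ennreal (vol1 n * R ^ n)"
proof -
  have R0: "(\<integral>\<^sup>+t. ennreal (t ^ (n - 1)) * indicator {0..R} t \<partial>lborel) = ennreal (R ^ n / n)"
    using nn_integral_power_Icc[OF n, of 0 R] n R by (simp add: power_0_left)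
  have "emeasure (Rn n) (ball_Rn n x R) = (\<integral>\<^sup>+y. indicator (ball_Rn n x R) y \<partial>Rn n)"
    by simp
  also have "\<dots> = (\<integral>\<^sup>+y. indicator (ball_Rn n x R) (\<lambda>i\<in>{..<n}. x i + 1 * y i) \<partial>Rn n)"
    by (subst nn_integral_Rn_affine[where s = 1 and x = x]) simp_all
  also have "\<dots> = (\<integral>\<^sup>+y. indicator {..<R} (nrm n y) \<partial>Rn n)"
    by (intro nn_integral_cong)
       (auto simp: ball_Rn_def space_lebesgue_Rn space_PiM L2_set_def split: split_indicator)
  also have "\<dots> = ennreal (real n * vol1 n) * (\<integral>\<^sup>+t\<in>{0..}. indicator {..<R} t * ennreal (t ^ (n - 1)) \<partial>lborel)"
    by (rule nn_integral_nrm[OF n]) simp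
  also have "(\<integral>\<^sup>+t\<in>{0..}. indicator {..<R} t * ennreal (t ^ (n - 1)) \<partial>lborel)
      = (\<integral>\<^sup>+t. ennreal (t ^ (n - 1)) * indicator {0..R} t \<partial>lborel)"
  proof (rule nn_integral_cong_AE)
    show "AE t in lborel. indicator {..<R} t * ennreal (t ^ (n - 1)) * indicator {0..} t
        = ennreal (t ^ (n - 1)) * indicator {0..R} t"
      using AE_lborel_singleton[of R] by eventually_elim (auto simp: indicator_def)
  qed
  also note R0
  also have "ennreal (real n * vol1 n) * ennreal (R ^ n / n) = ennreal (vol1 n * R ^ n)"
    using n R by (subst ennreal_mult[symmetric]) auto
  finally show ?thesis .
qed

lemma AE_nrm_pos: "1 \<le> n \<Longrightarrow> AE y in Rn n. 0 < nrm n y"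
proof -
  assume n: "1 \<le> n"
  have "{y \<in> space (Rn n). nrm n y \<le> 0} \<in> null_sets (Rn n)"
    using nrm_cball_volume[OF n, of 0] n by (intro null_setsI) (auto simp: power_0_left)
  then show ?thesis
    by (rule AE_I') auto
qed

lemma AE_nrmI:
  assumes n: "1 \<le> n" and P: "AE t in lborel. 0 < t \<longrightarrow> P t"
  shows "AE y in Rn n. P (nrm n y)"
proof -
  obtain N where N: "N \<in> null_sets lborel" "{t. \<not> (0 < t \<longrightarrow> P t)} \<subseteq> N"
    using P by (auto simp: eventually_ae_filter)
  then have [measurable]: "N \<in> sets borel" by auto
  have "(\<integral>\<^sup>+y. indicator N (nrm n y) \<partial>Rn n) = 0"
  proof (subst nn_integral_nrm[OF n])
    have "AE t in lborel. t \<notin> N" using AE_not_in[OF N(1)] .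
    then have "(\<integral>\<^sup>+t\<in>{0..}. indicator N t * ennreal (t ^ (n - 1)) \<partial>lborel) = 0"
      by (subst nn_integral_0_iff_AE) (auto elim!: eventually_mono)
    then show "ennreal (real n * vol1 n) * (\<integral>\<^sup>+t\<in>{0..}. indicator N t * ennreal (t ^ (n - 1)) \<partial>lborel) = 0"
      by simp
  qed auto
  then have "AE y in Rn n. indicator N (nrm n y) = (0::ennreal)"
    by (subst (asm) nn_integral_0_iff_AE) auto
  then show ?thesis
    using AE_nrm_pos[OF n]
  proof eventually_elim
    case (elim y)
    then have "nrm n y \<notin> N" by (auto simp: indicator_def split: if_splits)
    then show ?case using N(2) elim(2) by auto
  qed
qed

section \<open>Dilations, null sets and measurability of radial functions\<close>

abbreviation dilate :: "nat \<Rightarrow> real \<Rightarrow> (nat \<Rightarrow> real) \<Rightarrow> (nat \<Rightarrow> real)" where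
  "dilate n s y \<equiv> \<lambda>i\<in>{..<n}. s * y i"

lemma measurable_dilate [measurable]:
  "(\<lambda>p. dilate n (snd p) (fst p)) \<in> measurable (Rn n \<Otimes>\<^sub>M lborel) (Rn n)"
  "dilate n s \<in> measurable (Rn n) (Rn n)"
  "(\<lambda>s. dilate n s x) \<in> measurable lborel (Rn n)"
  "(\<lambda>s. dilate n s x) \<in> measurable borel (Rn n)"
  by measurable

lemma nrm_dilate: "0 \<le> s \<Longrightarrow> nrm n (dilate n s y) = s * nrm n y"
proof -
  assume "0 \<le> s"
  have "nrm n (dilate n s y) = nrm n (\<lambda>i. s * y i)"
    by (intro L2_set_cong) auto
  then show ?thesis using L2_set_right_distrib[OF \<open>0 \<le> s\<close>, of y "{..<n}"] by simp
qed

lemma pair_sigma_finite_Rn_lborel: "pair_sigma_finite (Rn n) (lborel :: real measure)"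
  using sigma_finite_Rn by (intro pair_sigma_finite.intro lborel.sigma_finite_measure_axioms)

text \<open>
  A null set has null dilates, so by Fubini almost every ray through the origin meets it in a
  null set of dilation factors.
\<close>

lemma AE_dilate:
  assumes "AE x in Rn n. P x"
  shows "AE x in Rn n. AE s in lborel. 0 < s \<longrightarrow> P (dilate n s x)"
proof -
  obtain N where N: "N \<in> null_sets (Rn n)" "{x \<in> space (Rn n). \<not> P x} \<subseteq> N"
    using assms by (auto simp: eventually_ae_filter)
  then have [measurable]: "N \<in> sets (Rn n)" by auto
  have zero: "(\<integral>\<^sup>+x. indicator N (dilate n s x) * indicator {0<..} s \<partial>Rn n) = (0::ennreal)" for s :: real
  proof (cases "0 < s")
    case True
    have "(\<integral>\<^sup>+x. indicator N x \<partial>Rn n) = (0::ennreal)"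
      using N(1) by auto
    moreover have "(\<integral>\<^sup>+x. indicator N x \<partial>Rn n) = ennreal (s ^ n) * (\<integral>\<^sup>+x. indicator N (dilate n s x) \<partial>Rn n)"
      using True by (subst nn_integral_Rn_affine[where s = s and x = "\<lambda>_. 0"]) (auto simp: restrict_def)
    ultimately have "(\<integral>\<^sup>+x. indicator N (dilate n s x) \<partial>Rn n) = (0::ennreal)"
      using True by auto
    then show ?thesis using True by simp
  qed auto
  have "(\<integral>\<^sup>+x. (\<integral>\<^sup>+s. indicator N (dilate n s x) * indicator {0<..} s \<partial>lborel) \<partial>Rn n)
      = (\<integral>\<^sup>+s. (\<integral>\<^sup>+x. indicator N (dilate n s x) * indicator {0<..} s \<partial>Rn n) \<partial>(lborel::real measure))"
    by (rule pair_sigma_finite.Fubini'[OF pair_sigma_finite_Rn_lborel, symmetric]) measurable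
  also have "\<dots> = (0::ennreal)"
    unfolding zero by simp
  finally have "AE x in Rn n. (\<integral>\<^sup>+s. indicator N (dilate n s x) * indicator {0<..} s \<partial>lborel) = (0::ennreal)"
  proof (subst (asm) nn_integral_0_iff_AE)
    show "(\<lambda>x. \<integral>\<^sup>+s. indicator N (dilate n s x) * indicator {0<..} s \<partial>(lborel::real measure))
        \<in> borel_measurable (Rn n)"
      by (rule lborel.borel_measurable_nn_integral) measurable
  qed
  then show ?thesis
  proof eventually_elim
    case (elim x)
    then have "AE s in lborel. indicator N (dilate n s x) * indicator {0<..} s = (0::ennreal)"
    proof (subst (asm) nn_integral_0_iff_AE)
      show "(\<lambda>s. indicator N (dilate n s x) * indicator {0<..} s :: ennreal) \<in> borel_measurable lborel"
        by measurable
    qed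
    then show ?case
    proof eventually_elim
      case (elim s)
      have "dilate n s x \<in> space (Rn n)" by (auto simp: space_PiM)
      with elim N(2) show ?case by (auto simp: indicator_def split: if_splits)
    qed
  qed
qed

lemma AE_Rn_ex:
  assumes n: "1 \<le> n" and P: "AE x in Rn n. P x"
  shows "\<exists>x\<in>space (Rn n). P x"
proof (rule ccontr)
  assume no: "\<not> (\<exists>x\<in>space (Rn n). P x)"
  have "AE x in Rn n. x \<notin> ball_Rn n (\<lambda>_. 0) 1"
    using P AE_space[of "Rn n"]
  proof eventually_elim
    case (elim x)
    with no show ?case by blast
  qed
  moreover have "{x \<in> space (Rn n). \<not> x \<notin> ball_Rn n (\<lambda>_. 0) 1} = ball_Rn n (\<lambda>_. 0) 1"
    by (auto simp: ball_Rn_def space_lebesgue_Rn)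
  ultimately have "emeasure (Rn n) (ball_Rn n (\<lambda>_. 0) 1) = 0"
    using AE_iff_measurable[of "ball_Rn n (\<lambda>_. 0) 1" "Rn n" "\<lambda>x. x \<notin> ball_Rn n (\<lambda>_. 0) 1"] by simp
  then show False
    using emeasure_ball_Rn[OF n, of 1] unit_ball_vol_pos[of "real n"] by simp
qed

lemma nn_integral_rescale:
  fixes r :: real
  assumes [measurable]: "f \<in> borel_measurable borel" and r: "0 < r"
  shows "(\<integral>\<^sup>+s. f (s * r) \<partial>lborel) = ennreal (1 / r) * (\<integral>\<^sup>+t. f t \<partial>lborel)"
proof -
  have "(\<integral>\<^sup>+t. f t \<partial>lborel) = ennreal r * (\<integral>\<^sup>+s. f (s * r) \<partial>lborel)"
    using r nn_integral_real_affine[of f r 0] by (simp add: mult.commute)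
  then show ?thesis
    using r by (simp add: mult.assoc[symmetric] ennreal_mult[symmetric])
qed

lemma AE_lborel_rescale:
  fixes c :: real
  assumes c: "0 < c" and P: "AE s in lborel. 0 < s \<longrightarrow> P (s * c)"
  shows "AE t in lborel. 0 < t \<longrightarrow> P t"
proof -
  obtain N where N: "N \<in> null_sets lborel" "{s. \<not> (0 < s \<longrightarrow> P (s * c))} \<subseteq> N"
    using P by (auto simp: eventually_ae_filter)
  then have [measurable]: "N \<in> sets borel" by auto
  have "(\<integral>\<^sup>+t. indicator N (t * (1 / c)) \<partial>lborel) = ennreal c * (\<integral>\<^sup>+s. indicator N s \<partial>lborel)"
    using c by (subst nn_integral_rescale) auto
  also have "\<dots> = 0" using N(1) by auto
  finally have "AE t in lborel. indicator N (t * (1 / c)) = (0::ennreal)"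
    by (subst (asm) nn_integral_0_iff_AE) auto
  then show ?thesis
  proof eventually_elim
    case (elim t)
    then have "t / c \<notin> N" by (auto simp: indicator_def split: if_splits)
    then have "0 < t / c \<longrightarrow> P (t / c * c)" using N(2) by blast
    then show ?case using c by simp
  qed
qed

text \<open>
  One generic direction \<open>x\<close> already decides almost every radius, since \<open>|s x| = s |x|\<close>. The
  predicate is arbitrary, so no measurability of the set of good radii has to be known beforehand.
\<close>

lemma AE_nrmD:
  assumes n: "1 \<le> n" and P: "AE x in Rn n. P (nrm n x)"
  shows "AE t in lborel. 0 < t \<longrightarrow> P t"
proof -
  have "AE x in Rn n. 0 < nrm n x \<and> (AE s in lborel. 0 < s \<longrightarrow> P (nrm n (dilate n s x)))"
    by (rule eventually_conj[OF AE_nrm_pos[OF n] AE_dilate[OF P]])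
  from AE_Rn_ex[OF n this] obtain x where x: "0 < nrm n x" "AE s in lborel. 0 < s \<longrightarrow> P (nrm n (dilate n s x))"
    by blast
  from x(2) have "AE s in lborel. 0 < s \<longrightarrow> P (s * nrm n x)"
    by eventually_elim (simp add: nrm_dilate)
  with x(1) show ?thesis by (rule AE_lborel_rescale)
qed

text \<open>
  Replace \<open>w\<close> by a Borel function on \<open>\<real>\<^sup>n\<close> that equals it almost everywhere and restrict the
  latter to a generic ray: there \<open>w(s x) = w0(s |x|)\<close>.
\<close>

lemma radial_borel_representative:
  assumes n: "1 \<le> n" and meas: "radial n w0 \<in> borel_measurable (lebesgue_Rn n)"
  obtains h :: "real \<Rightarrow> real" where "h \<in> borel_measurable borel"
    "AE t in lborel. 0 < t \<longrightarrow> w0 t = h t"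
proof -
  obtain g where g [measurable]: "g \<in> borel_measurable (Rn n)" and g_eq: "AE x in Rn n. radial n w0 x = g x"
    using completion_ex_borel_measurable_real[OF meas[unfolded lebesgue_Rn_def]] by blast
  have "AE x in Rn n. 0 < nrm n x \<and> (AE s in lborel. 0 < s \<longrightarrow> w0 (nrm n (dilate n s x)) = g (dilate n s x))"
    using eventually_conj[OF AE_nrm_pos[OF n] AE_dilate[OF g_eq]] unfolding radial_def .
  from AE_Rn_ex[OF n this] obtain x where x: "0 < nrm n x" "AE s in lborel. 0 < s \<longrightarrow> w0 (nrm n (dilate n s x)) = g (dilate n s x)"
    by blast
  let ?h = "\<lambda>t. g (dilate n (t / nrm n x) x)"
  have "(\<lambda>t. dilate n (t / nrm n x) x) \<in> measurable borel (Rn n)" by measurable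
  then have "?h \<in> borel_measurable borel" by measurable
  moreover from x(2) have "AE s in lborel. 0 < s \<longrightarrow> w0 (s * nrm n x) = ?h (s * nrm n x)"
    by eventually_elim (use x(1) in \<open>simp add: nrm_dilate\<close>)
  from AE_lborel_rescale[OF x(1) this] have "AE t in lborel. 0 < t \<longrightarrow> w0 t = ?h t" .
  ultimately show thesis by (rule that)
qed

lemma measurable_completion_AE_cong:
  fixes f g :: "'a \<Rightarrow> real"
  assumes g: "g \<in> borel_measurable M" and eq: "AE x in M. f x = g x"
  shows "f \<in> borel_measurable (completion M)"
proof (rule measurableI)
  fix A :: "real set" assume A: "A \<in> sets borel"
  have 1: "g -` A \<inter> space M \<in> sets (completion M)"
    using measurable_sets[OF g A] by simp
  have 2: "AE x in completion M. x \<in> g -` A \<inter> space M \<longleftrightarrow> x \<in> f -` A \<inter> space M"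
    using AE_completion[OF eq] by eventually_elim simp
  have 3: "f -` A \<inter> space M \<subseteq> space (completion M)"
    by simp
  show "f -` A \<inter> space (completion M) \<in> sets (completion M)"
    unfolding space_completion by (rule completion.in_sets_AE[OF 2 1 3])
qed auto

lemma radial_measurable:
  assumes "1 \<le> n" "h \<in> borel_measurable borel" "AE t in lborel. 0 < t \<longrightarrow> w0 t = h t"
  shows "radial n w0 \<in> borel_measurable (lebesgue_Rn n)"
  unfolding lebesgue_Rn_def
proof (rule measurable_completion_AE_cong)
  show "(\<lambda>x. h (nrm n x)) \<in> borel_measurable (Rn n)"
    using assms(2) measurable_nrm by (rule measurable_compose_rev)
  show "AE x in Rn n. radial n w0 x = h (nrm n x)"
    using AE_nrmI[OF assms(1,3)] by (simp add: radial_def)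
qed

lemma locally_integrable_Rn_imp_measurable:
  assumes "locally_integrable_Rn n g"
  shows "g \<in> borel_measurable (lebesgue_Rn n)"
proof (rule borel_measurable_LIMSEQ_real)
  let ?B = "\<lambda>k::nat. ball_Rn n (\<lambda>i\<in>{..<n}. 0) (real (Suc k))"
  show "(\<lambda>x. indicator (?B k) x * g x) \<in> borel_measurable (lebesgue_Rn n)" for k
  proof -
    have "set_integrable (lebesgue_Rn n) (?B k) g"
      using assms by (auto simp: locally_integrable_Rn_def space_lebesgue_Rn space_PiM)
    then show ?thesis
      using borel_measurable_integrable by (force simp: set_integrable_def)
  qed
  fix x assume x: "x \<in> space (lebesgue_Rn n)"
  obtain k0 :: nat where k0: "nrm n x < real k0" using reals_Archimedean2 by blast
  have "indicator (?B k) x * g x = g x" if "k0 \<le> k" for k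
  proof -
    have "L2_set (\<lambda>i. x i - (\<lambda>i\<in>{..<n}. 0) i) {..<n} = nrm n x"
      by (intro L2_set_cong) auto
    then have "x \<in> ?B k"
      using x k0 that by (simp add: ball_Rn_def)
    then show ?thesis by simp
  qed
  then show "(\<lambda>k. indicator (?B k) x * g x) \<longlonglongrightarrow> g x"
    by (intro tendsto_eventually eventually_sequentiallyI[of k0])
qed

section \<open>Integrals of radial functions over balls and over intervals\<close>

lemma nrm_in_ball:
  assumes "y \<in> ball_Rn n x R"
  shows "nrm n x - R < nrm n y" "nrm n y < nrm n x + R"
proof -
  have yx: "L2_set (\<lambda>i. y i - x i) {..<n} < R" using assms by (simp add: ball_Rn_def)
  have "nrm n y \<le> nrm n x + L2_set (\<lambda>i. y i - x i) {..<n}"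
    using L2_set_triangle_ineq[of x "\<lambda>i. y i - x i" "{..<n}"] by simp
  then show "nrm n y < nrm n x + R" using yx by simp
  have "nrm n x \<le> nrm n y + L2_set (\<lambda>i. x i - y i) {..<n}"
    using L2_set_triangle_ineq[of y "\<lambda>i. x i - y i" "{..<n}"] by simp
  moreover have "L2_set (\<lambda>i. x i - y i) {..<n} = L2_set (\<lambda>i. y i - x i) {..<n}"
    by (simp add: L2_set_def power2_commute)
  ultimately show "nrm n x - R < nrm n y" using yx by simp
qed

lemma ball_Rn_mono:
  assumes "R + L2_set (\<lambda>i. x i - z i) {..<n} \<le> R'"
  shows "ball_Rn n x R \<subseteq> ball_Rn n z R'"
proof
  fix y assume y: "y \<in> ball_Rn n x R"
  have "L2_set (\<lambda>i. y i - z i) {..<n} \<le> L2_set (\<lambda>i. y i - x i) {..<n} + L2_set (\<lambda>i. x i - z i) {..<n}"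
    using L2_set_triangle_ineq[of "\<lambda>i. y i - x i" "\<lambda>i. x i - z i" "{..<n}"] by simp
  then show "y \<in> ball_Rn n z R'"
    using y assms by (simp add: ball_Rn_def)
qed

lemma nn_integral_ball_dilate:
  assumes [measurable]: "f \<in> borel_measurable borel" "B \<in> sets (Rn n)" and s: "0 < s"
  shows "(\<integral>\<^sup>+y\<in>B. f (nrm n y) \<partial>Rn n)
       = ennreal (s ^ n) * (\<integral>\<^sup>+y. f (s * nrm n y) * indicator B (dilate n s y) \<partial>Rn n)"
proof -
  have "(\<integral>\<^sup>+y\<in>B. f (nrm n y) \<partial>Rn n) = ennreal (s ^ n) *
     (\<integral>\<^sup>+y. f (nrm n (\<lambda>i\<in>{..<n}. 0 + s * y i)) * indicator B (\<lambda>i\<in>{..<n}. 0 + s * y i) \<partial>Rn n)"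
    using s by (intro nn_integral_Rn_affine[where x = "\<lambda>_. 0"]) auto
  then show ?thesis using s by (simp add: nrm_dilate)
qed

lemma nn_integral_dilate_swap:
  assumes [measurable]: "f \<in> borel_measurable borel" "B \<in> sets (Rn n)" "S \<in> sets borel"
  shows "(\<integral>\<^sup>+s\<in>S. (\<integral>\<^sup>+y\<in>B. f (s * nrm n y) \<partial>Rn n) \<partial>lborel)
       = (\<integral>\<^sup>+y\<in>B. (\<integral>\<^sup>+s\<in>S. f (s * nrm n y) \<partial>lborel) \<partial>Rn n)"
proof -
  have [measurable]: "nrm n \<in> borel_measurable (Rn n)" by (rule measurable_nrm)
  have "(\<integral>\<^sup>+s\<in>S. (\<integral>\<^sup>+y\<in>B. f (s * nrm n y) \<partial>Rn n) \<partial>lborel)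
      = (\<integral>\<^sup>+s. (\<integral>\<^sup>+y. f (s * nrm n y) * indicator B y * indicator S s \<partial>Rn n) \<partial>lborel)"
    by (simp add: nn_integral_multc)
  also have "\<dots> = (\<integral>\<^sup>+y. (\<integral>\<^sup>+s. f (s * nrm n y) * indicator B y * indicator S s \<partial>lborel) \<partial>Rn n)"
    by (rule pair_sigma_finite.Fubini'[OF pair_sigma_finite_Rn_lborel]) measurable
  also have "\<dots> = (\<integral>\<^sup>+y. (\<integral>\<^sup>+s. (f (s * nrm n y) * indicator S s) * indicator B y \<partial>lborel) \<partial>Rn n)"
    by (simp add: ac_simps)
  also have "\<dots> = (\<integral>\<^sup>+y\<in>B. (\<integral>\<^sup>+s\<in>S. f (s * nrm n y) \<partial>lborel) \<partial>Rn n)"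
    by (simp add: nn_integral_multc)
  finally show ?thesis .
qed

lemma dist_dilate_le:
  assumes "0 \<le> s"
  shows "L2_set (\<lambda>i. s * y i - x i) {..<n} \<le> s * L2_set (\<lambda>i. y i - x i) {..<n} + \<bar>s - 1\<bar> * nrm n x"
proof -
  have "L2_set (\<lambda>i. s * y i - x i) {..<n} = L2_set (\<lambda>i. s * (y i - x i) + (s - 1) * x i) {..<n}"
    by (intro L2_set_cong) (auto simp: algebra_simps)
  also have "\<dots> \<le> L2_set (\<lambda>i. s * (y i - x i)) {..<n} + L2_set (\<lambda>i. (s - 1) * x i) {..<n}"
    by (rule L2_set_triangle_ineq)
  also have "L2_set (\<lambda>i. (s - 1) * x i) {..<n} = L2_set (\<lambda>i. \<bar>s - 1\<bar> * x i) {..<n}"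
    by (simp add: L2_set_def power_mult_distrib)
  finally show ?thesis
    using assms by (simp add: L2_set_right_distrib)
qed

lemma ball_Rn_dilateI:
  assumes s: "0 < s" and y: "y \<in> ball_Rn n x r" and R: "s * r + \<bar>s - 1\<bar> * nrm n x \<le> R"
  shows "dilate n s y \<in> ball_Rn n x R"
proof -
  have "L2_set (\<lambda>i. dilate n s y i - x i) {..<n} = L2_set (\<lambda>i. s * y i - x i) {..<n}"
    by (intro L2_set_cong) auto
  also have "\<dots> \<le> s * L2_set (\<lambda>i. y i - x i) {..<n} + \<bar>s - 1\<bar> * nrm n x"
    using s by (intro dist_dilate_le) simp
  also have "\<dots> < s * r + \<bar>s - 1\<bar> * nrm n x"
    using y s by (simp add: ball_Rn_def)
  finally show ?thesis
    using R by (auto simp: ball_Rn_def space_lebesgue_Rn space_PiM)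
qed

text \<open>
  Dividing by \<open>s\<close> contracts distances, so the ball has to grow only by the displacement
  \<open>(s - 1) |x|\<close> of its centre.
\<close>

lemma ball_Rn_dilateD:
  assumes s: "1 \<le> s" and y: "y \<in> space (Rn n)" and sy: "dilate n s y \<in> ball_Rn n x r"
    and R: "r + (s - 1) * nrm n x \<le> R"
  shows "y \<in> ball_Rn n x R"
proof -
  have "L2_set (\<lambda>i. s * y i - x i) {..<n} = L2_set (\<lambda>i. dilate n s y i - x i) {..<n}"
    by (intro L2_set_cong) auto
  also have "\<dots> < r" using sy by (simp add: ball_Rn_def)
  finally have less: "L2_set (\<lambda>i. s * y i - x i) {..<n} < r" .
  have "L2_set (\<lambda>i. y i - x i) {..<n} \<le> s * L2_set (\<lambda>i. y i - x i) {..<n}"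
    using mult_right_mono[OF s, of "L2_set (\<lambda>i. y i - x i) {..<n}"] by simp
  also have "\<dots> = L2_set (\<lambda>i. (s * y i - x i) + (1 - s) * x i) {..<n}"
    using s by (subst L2_set_right_distrib) (auto simp: algebra_simps)
  also have "\<dots> \<le> L2_set (\<lambda>i. s * y i - x i) {..<n} + L2_set (\<lambda>i. (1 - s) * x i) {..<n}"
    by (rule L2_set_triangle_ineq)
  also have "L2_set (\<lambda>i. (1 - s) * x i) {..<n} = L2_set (\<lambda>i. (s - 1) * x i) {..<n}"
    by (simp add: L2_set_def power_mult_distrib power2_commute)
  also have "\<dots> = (s - 1) * nrm n x"
    using s by (simp add: L2_set_right_distrib)
  finally show ?thesis
    using y R less by (simp add: ball_Rn_def space_lebesgue_Rn)
qed

text \<open>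
  The upper bound for the density of \<open>|y|\<close>, \<open>y\<close> uniform in a ball. For every dilation factor
  \<open>s \<in> [1, 1 + \<epsilon>]\<close> the set \<open>s B'\<close>, where \<open>B'\<close> is the concentric ball of radius \<open>(1 + 1/n) R\<close>,
  contains \<open>B\<close>; this is what \<open>n * \<epsilon> * |x| \<le> R\<close> is for. Averaging over \<open>s\<close> turns the integral over
  \<open>B\<close> into integrals of \<open>f\<close> over \<open>[|y|, (1 + \<epsilon>) |y|]\<close>, divided by \<open>|y| \<ge> a/2\<close>. Both the Jacobian
  \<open>s ^ n\<close> and the enlargement of the ball cost a factor of at most \<open>(1 + 1/n) ^ n \<le> e\<close>, whence
  \<open>exp 2\<close>.
\<close>

lemma ball_integral_le_radial_integral:
  assumes n: "1 \<le> n" and f [measurable]: "f \<in> borel_measurable borel"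
    and R: "0 < R" and eps: "0 < \<epsilon>" "n * \<epsilon> \<le> 1" "n * \<epsilon> * nrm n x \<le> R"
    and a: "0 < a" and supp: "\<And>t. t < a \<Longrightarrow> f t = 0"
  shows "(\<integral>\<^sup>+y\<in>ball_Rn n x R. f (nrm n y) \<partial>Rn n)
       \<le> ennreal (2 * exp 2 / (\<epsilon> * a)) * emeasure (Rn n) (ball_Rn n x R) * (\<integral>\<^sup>+t. f t \<partial>lborel)"
proof -
  define R' where "R' = R * (1 + 1 / n)"
  define J where "J = (\<integral>\<^sup>+y\<in>ball_Rn n x R. f (nrm n y) \<partial>Rn n)"
  define F where "F = (\<integral>\<^sup>+t. f t \<partial>lborel)"
  let ?S = "{1..1 + \<epsilon>}"
  have R': "0 < R'" using R n by (simp add: R'_def add_pos_nonneg)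
  have \<epsilon>1: "\<epsilon> \<le> 1" and \<epsilon>n: "\<epsilon> \<le> 1 / n"
  proof -
    show "\<epsilon> \<le> 1 / n" using eps(2) n by (simp add: field_simps)
    also have "\<dots> \<le> 1" using n by simp
    finally show "\<epsilon> \<le> 1" .
  qed
  have exp1: "(1 + 1 / real n) ^ n \<le> exp 1"
  proof -
    have "(1 + 1 / real n) ^ n \<le> exp (1 / real n) ^ n"
      by (intro power_mono exp_ge_add_one_self) auto
    also have "\<dots> = exp 1" using n by (simp add: exp_of_nat_mult[symmetric])
    finally show ?thesis .
  qed
  have J_le: "J \<le> ennreal (exp 1) * (\<integral>\<^sup>+y\<in>ball_Rn n x R'. f (s * nrm n y) \<partial>Rn n)" if s: "s \<in> ?S" for s
  proof -
    have s1: "1 \<le> s" "s - 1 \<le> \<epsilon>" using s by auto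
    have "n * ((s - 1) * nrm n x) \<le> n * (\<epsilon> * nrm n x)"
      using s1 by (intro mult_left_mono mult_right_mono) auto
    also have "\<dots> \<le> R" using eps(3) by (simp add: ac_simps)
    finally have "R + (s - 1) * nrm n x \<le> R'"
      using n by (simp add: R'_def field_simps)
    then have sub: "y \<in> ball_Rn n x R'" if "y \<in> space (Rn n)" "dilate n s y \<in> ball_Rn n x R" for y
      using ball_Rn_dilateD[OF s1(1) that] by blast
    have "s ^ n \<le> (1 + 1 / n) ^ n"
      using s1 \<epsilon>n by (intro power_mono) auto
    with exp1 have sn: "s ^ n \<le> exp 1" by simp
    have "J = ennreal (s ^ n) * (\<integral>\<^sup>+y. f (s * nrm n y) * indicator (ball_Rn n x R) (dilate n s y) \<partial>Rn n)"
      unfolding J_def using s1 by (intro nn_integral_ball_dilate) auto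
    also have "\<dots> \<le> ennreal (exp 1) * (\<integral>\<^sup>+y\<in>ball_Rn n x R'. f (s * nrm n y) \<partial>Rn n)"
      using sub sn by (intro mult_mono nn_integral_mono ennreal_leI) (auto split: split_indicator)
    finally show ?thesis .
  qed
  have inner: "(\<integral>\<^sup>+s\<in>?S. f (s * r) \<partial>lborel) \<le> ennreal (2 / a) * F" if r: "0 \<le> r" for r
  proof (cases "2 * r < a")
    case True
    have zero: "f (s * r) * indicator ?S s = 0" for s
    proof (cases "s \<in> ?S")
      case True
      then have "s * r \<le> 2 * r" using \<epsilon>1 r by (intro mult_right_mono) auto
      then show ?thesis using supp[of "s * r"] \<open>2 * r < a\<close> by simp
    qed auto
    show ?thesis by (simp only: zero nn_integral_const) simp
  next
    case False
    then have r: "0 < r" "1 / r \<le> 2 / a" using a by (auto simp: field_simps)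
    have "(\<integral>\<^sup>+s\<in>?S. f (s * r) \<partial>lborel) \<le> (\<integral>\<^sup>+s. f (s * r) \<partial>lborel)"
      by (intro nn_integral_mono) (auto split: split_indicator)
    also have "\<dots> = ennreal (1 / r) * F"
      unfolding F_def using r by (intro nn_integral_rescale) auto
    also have "\<dots> \<le> ennreal (2 / a) * F"
      using r by (intro mult_right_mono ennreal_leI) auto
    finally show ?thesis .
  qed
  have vol: "emeasure (Rn n) (ball_Rn n x R') \<le> ennreal (exp 1) * emeasure (Rn n) (ball_Rn n x R)"
  proof -
    have "R' ^ n = (1 + 1 / n) ^ n * R ^ n"
      by (simp add: R'_def power_mult_distrib)
    also have "\<dots> \<le> exp 1 * R ^ n"
      using exp1 R by (intro mult_right_mono) auto
    finally have "vol1 n * R' ^ n \<le> exp 1 * (vol1 n * R ^ n)"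
      by (simp add: mult.left_commute mult_left_mono)
    then show ?thesis
      using R by (simp add: emeasure_ball_Rn[OF n R'] emeasure_ball_Rn[OF n R] ennreal_leI ennreal_mult[symmetric])
  qed
  have "ennreal \<epsilon> * J = (\<integral>\<^sup>+s\<in>?S. J \<partial>lborel)"
    using eps by (subst nn_integral_cmult_indicator) (auto simp: mult.commute)
  also have "\<dots> \<le> (\<integral>\<^sup>+s\<in>?S. ennreal (exp 1) * (\<integral>\<^sup>+y\<in>ball_Rn n x R'. f (s * nrm n y) \<partial>Rn n) \<partial>lborel)"
    using J_le by (intro nn_integral_mono) (auto split: split_indicator)
  also have "\<dots> = ennreal (exp 1) * (\<integral>\<^sup>+s\<in>?S. (\<integral>\<^sup>+y\<in>ball_Rn n x R'. f (s * nrm n y) \<partial>Rn n) \<partial>lborel)"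
  proof -
    interpret sigma_finite_measure "Rn n" by (rule sigma_finite_Rn)
    have [measurable]: "nrm n \<in> borel_measurable (Rn n)" by (rule measurable_nrm)
    have "(\<lambda>s. \<integral>\<^sup>+y\<in>ball_Rn n x R'. f (s * nrm n y) \<partial>Rn n) \<in> borel_measurable lborel"
      by measurable
    then show ?thesis by (simp add: mult.assoc nn_integral_cmult)
  qed
  also have "\<dots> = ennreal (exp 1) * (\<integral>\<^sup>+y\<in>ball_Rn n x R'. (\<integral>\<^sup>+s\<in>?S. f (s * nrm n y) \<partial>lborel) \<partial>Rn n)"
    by (subst nn_integral_dilate_swap) auto
  also have "\<dots> \<le> ennreal (exp 1) * (\<integral>\<^sup>+y\<in>ball_Rn n x R'. ennreal (2 / a) * F \<partial>Rn n)"
    using inner by (intro mult_left_mono nn_integral_mono) (auto split: split_indicator)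
  also have "(\<integral>\<^sup>+y\<in>ball_Rn n x R'. ennreal (2 / a) * F \<partial>Rn n) = ennreal (2 / a) * F * emeasure (Rn n) (ball_Rn n x R')"
    by (subst nn_integral_cmult_indicator) auto
  also have "ennreal (exp 1) * \<dots> \<le> ennreal (exp 1) * (ennreal (2 / a) * F * (ennreal (exp 1) * emeasure (Rn n) (ball_Rn n x R)))"
    using vol by (intro mult_left_mono) auto
  finally have "J \<le> ennreal (1 / \<epsilon>) * (ennreal (exp 1) * (ennreal (2 / a) * F * (ennreal (exp 1) * emeasure (Rn n) (ball_Rn n x R))))"
    using eps by (intro ennreal_cmult_le_imp_le) auto
  also have "\<dots> = (ennreal (1 / \<epsilon>) * ennreal (exp 1) * ennreal (2 / a) * ennreal (exp 1)) * emeasure (Rn n) (ball_Rn n x R) * F"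
    by (simp add: ac_simps)
  also have "ennreal (1 / \<epsilon>) * ennreal (exp 1) * ennreal (2 / a) * ennreal (exp 1) = ennreal (2 * exp 2 / (\<epsilon> * a))"
    using eps a by (simp add: ennreal_mult[symmetric] exp_add[symmetric] flip: mult.assoc)
  finally show ?thesis by (simp add: J_def F_def)
qed

text \<open>
  The converse estimate, with a constant exponential in the dimension. For each \<open>y\<close> in the ball of
  radius \<open>R\<close> the radii \<open>s |y|\<close> with \<open>s0 \<le> s \<le> s1\<close> sweep over the whole interval
  \<open>[\<rho> - R, \<rho> + R]\<close>. As \<open>R \<le> \<rho>/2\<close>, these factors lie in \<open>[1/3, 3]\<close> and move the centre by at most
  \<open>4 R\<close>, so the dilated ball stays within radius \<open>3 R + 4 R\<close>.
\<close>

lemma interval_integral_le_ball_integral: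
  assumes n: "1 \<le> n" and f [measurable]: "f \<in> borel_measurable borel"
    and R: "0 < R" "2 * R \<le> nrm n x"
  defines "\<rho> \<equiv> nrm n x"
  shows "emeasure (Rn n) (ball_Rn n x R) * (\<integral>\<^sup>+t\<in>{\<rho> - R..\<rho> + R}. f t \<partial>lborel)
       \<le> ennreal (9 * 3 ^ n * R) * (\<integral>\<^sup>+y\<in>ball_Rn n x (7 * R). f (nrm n y) \<partial>Rn n)"
proof -
  define s0 s1 where "s0 = (\<rho> - R) / (\<rho> + R)" and "s1 = (\<rho> + R) / (\<rho> - R)"
  define J where "J = (\<integral>\<^sup>+y\<in>ball_Rn n x (7 * R). f (nrm n y) \<partial>Rn n)"
  define F where "F = (\<integral>\<^sup>+t\<in>{\<rho> - R..\<rho> + R}. f t \<partial>lborel)"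
  have \<rho>: "0 < \<rho>" "2 * R \<le> \<rho>" using R by (auto simp: \<rho>_def)
  have s0: "1 / 3 \<le> s0" "(1 - s0) * \<rho> \<le> 2 * R" "s0 \<le> 1"
    using R \<rho> by (auto simp: s0_def field_simps)
  have s1: "s1 \<le> 3" "(s1 - 1) * \<rho> \<le> 4 * R" "1 \<le> s1"
    using R \<rho> mult_left_mono[of "2 * R" \<rho> R] by (auto simp: s1_def field_simps)
  have J_ge: "(\<integral>\<^sup>+y\<in>ball_Rn n x R. f (s * nrm n y) \<partial>Rn n) \<le> ennreal (3 ^ n) * J" if s: "s \<in> {s0..s1}" for s
  proof -
    have s3: "1 / 3 \<le> s" "s \<le> 3" using s s0 s1 by auto
    have "\<bar>s - 1\<bar> * \<rho> \<le> 4 * R"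
    proof (cases "s \<le> 1")
      case True
      then have "\<bar>s - 1\<bar> * \<rho> \<le> (1 - s0) * \<rho>" using s \<rho> by (intro mult_right_mono) auto
      then show ?thesis using s0 R by simp
    next
      case False
      then have "\<bar>s - 1\<bar> * \<rho> \<le> (s1 - 1) * \<rho>" using s \<rho> by (intro mult_right_mono) auto
      then show ?thesis using s1 R by simp
    qed
    moreover have "s * R \<le> 3 * R" using s3 R by (intro mult_right_mono) auto
    ultimately have "s * R + \<bar>s - 1\<bar> * nrm n x \<le> 7 * R" by (simp add: \<rho>_def)
    then have sub: "dilate n s y \<in> ball_Rn n x (7 * R)" if "y \<in> ball_Rn n x R" for y
      using s3 that by (intro ball_Rn_dilateI) auto
    have "(1 / 3) ^ n \<le> s ^ n" using s3 by (intro power_mono) auto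
    have "ennreal (s ^ n) * (\<integral>\<^sup>+y\<in>ball_Rn n x R. f (s * nrm n y) \<partial>Rn n)
        \<le> ennreal (s ^ n) * (\<integral>\<^sup>+y. f (s * nrm n y) * indicator (ball_Rn n x (7 * R)) (dilate n s y) \<partial>Rn n)"
      using sub by (intro mult_left_mono nn_integral_mono) (auto split: split_indicator)
    also have "\<dots> = J"
      unfolding J_def using s3 by (subst nn_integral_ball_dilate[where s = s]) auto
    finally have "(\<integral>\<^sup>+y\<in>ball_Rn n x R. f (s * nrm n y) \<partial>Rn n) \<le> ennreal (1 / s ^ n) * J"
      using s3 by (intro ennreal_cmult_le_imp_le) auto
    also have "\<dots> \<le> ennreal (3 ^ n) * J"
    proof (intro mult_right_mono ennreal_leI)
      have "1 / s ^ n = (1 / s) ^ n" by (simp add: power_one_over)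
      also have "\<dots> \<le> 3 ^ n" using s3 by (intro power_mono) (auto simp: field_simps)
      finally show "1 / s ^ n \<le> 3 ^ n" .
    qed simp
    finally show ?thesis .
  qed
  have inner: "ennreal (2 / (3 * \<rho>)) * F \<le> (\<integral>\<^sup>+s\<in>{s0..s1}. f (s * nrm n y) \<partial>lborel)" if y: "y \<in> ball_Rn n x R" for y
  proof -
    have r: "\<rho> - R < nrm n y" "nrm n y < \<rho> + R"
      using nrm_in_ball[OF y] by (auto simp: \<rho>_def)
    then have r0: "0 < nrm n y" using R \<rho> by linarith
    have cover: "t / nrm n y \<in> {s0..s1}" if "t \<in> {\<rho> - R..\<rho> + R}" for t
    proof -
      have "(\<rho> - R) / (\<rho> + R) \<le> t / nrm n y" "t / nrm n y \<le> (\<rho> + R) / (\<rho> - R)"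
        using that r r0 R \<rho> by (auto intro!: frac_le)
      then show ?thesis by (simp add: s0_def s1_def)
    qed
    have "ennreal (2 / (3 * \<rho>)) * F \<le> ennreal (1 / nrm n y) * F"
      using r r0 R \<rho> by (intro mult_right_mono ennreal_leI) (auto simp: field_simps)
    also have "\<dots> \<le> ennreal (1 / nrm n y) * (\<integral>\<^sup>+t. f t * indicator {s0..s1} (t / nrm n y) \<partial>lborel)"
      unfolding F_def using cover
      by (intro mult_left_mono nn_integral_mono) (auto split: split_indicator)
    also have "\<dots> = (\<integral>\<^sup>+s. f (s * nrm n y) * indicator {s0..s1} (s * nrm n y / nrm n y) \<partial>lborel)"
      using r0 by (subst nn_integral_rescale) auto
    finally show ?thesis using r0 by simp
  qed
  have "ennreal (2 / (3 * \<rho>)) * (emeasure (Rn n) (ball_Rn n x R) * F)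
      = (\<integral>\<^sup>+y\<in>ball_Rn n x R. ennreal (2 / (3 * \<rho>)) * F \<partial>Rn n)"
    by (subst nn_integral_cmult_indicator) (auto simp: ac_simps)
  also have "\<dots> \<le> (\<integral>\<^sup>+y\<in>ball_Rn n x R. (\<integral>\<^sup>+s\<in>{s0..s1}. f (s * nrm n y) \<partial>lborel) \<partial>Rn n)"
    using inner by (intro nn_integral_mono) (auto split: split_indicator)
  also have "\<dots> = (\<integral>\<^sup>+s\<in>{s0..s1}. (\<integral>\<^sup>+y\<in>ball_Rn n x R. f (s * nrm n y) \<partial>Rn n) \<partial>lborel)"
    by (subst nn_integral_dilate_swap) auto
  also have "\<dots> \<le> (\<integral>\<^sup>+s\<in>{s0..s1}. ennreal (3 ^ n) * J \<partial>lborel)"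
    using J_ge by (intro nn_integral_mono) (auto split: split_indicator)
  also have "\<dots> = ennreal (3 ^ n) * J * ennreal (s1 - s0)"
    using s0 s1 by (subst nn_integral_cmult_indicator) auto
  also have "\<dots> \<le> ennreal (3 ^ n) * J * ennreal (6 * R / \<rho>)"
    using s0 s1 \<rho> R by (intro mult_left_mono ennreal_leI) (auto simp: field_simps)
  finally have "emeasure (Rn n) (ball_Rn n x R) * F
      \<le> ennreal (1 / (2 / (3 * \<rho>))) * (ennreal (3 ^ n) * J * ennreal (6 * R / \<rho>))"
    using \<rho> by (intro ennreal_cmult_le_imp_le) auto
  also have "\<dots> = ennreal (1 / (2 / (3 * \<rho>))) * ennreal (3 ^ n) * ennreal (6 * R / \<rho>) * J"
    by (simp add: ac_simps)
  also have "ennreal (1 / (2 / (3 * \<rho>))) * ennreal (3 ^ n) * ennreal (6 * R / \<rho>) = ennreal (9 * 3 ^ n * R)"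
    using \<rho> R by (simp add: ennreal_mult[symmetric] flip: mult.assoc)
  finally show ?thesis by (simp add: J_def F_def)
qed

section \<open>Maximal averages in different dimensions\<close>

lemma nn_integral_abs_radial:
  assumes n: "1 \<le> n" and w0: "\<forall>t\<ge>0. 0 \<le> w0 t" and h: "AE t in lborel. 0 < t \<longrightarrow> w0 t = h t"
  shows "(\<integral>\<^sup>+y\<in>B. ennreal \<bar>radial n w0 y\<bar> \<partial>lebesgue_Rn n) = (\<integral>\<^sup>+y\<in>B. ennreal (h (nrm n y)) \<partial>Rn n)"
  unfolding lebesgue_Rn_def nn_integral_completion
proof (rule nn_integral_cong_AE)
  show "AE y in Rn n. ennreal \<bar>radial n w0 y\<bar> * indicator B y = ennreal (h (nrm n y)) * indicator B y"
    using AE_nrmI[OF n h]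
  proof eventually_elim
    case (elim y)
    then show ?case using w0[rule_format, of "nrm n y"] by (simp add: radial_def)
  qed
qed

text \<open>
  Reduces the maximal inequality for radial weights to Borel functions and to the uncompleted product
  measure, where Fubini's theorem is available.
\<close>

lemma maximal_op_radial_le_iff:
  assumes n: "1 \<le> n" and w0: "\<forall>t\<ge>0. 0 \<le> w0 t"
    and h: "AE t in lborel. 0 < t \<longrightarrow> w0 t = h t"
  shows "maximal_op n (radial n w0) x \<le> K
     \<longleftrightarrow> (\<forall>R>0. (\<integral>\<^sup>+y\<in>ball_Rn n x R. ennreal (h (nrm n y)) \<partial>Rn n) \<le> K * ennreal (vol1 n * R ^ n))"
proof -
  note eq = nn_integral_abs_radial[OF n w0 h]
  have vol: "emeasure (lebesgue_Rn n) (ball_Rn n x R) = ennreal (vol1 n * R ^ n)" if "0 < R" for R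
    using emeasure_ball_Rn[OF n that, of x] by (simp add: lebesgue_Rn_def)
  note div = ennreal_divide_le_iff
  have pos: "0 < vol1 n * R ^ n" if "0 < R" for R using that by simp
  show ?thesis
    unfolding maximal_op_def SUP_le_iff by (auto simp: eq vol div pos)
qed

text \<open>
  Both integrals are compared with integrals of \<open>f\<close> over intervals, so only the common distance \<open>\<rho>\<close> of
  the two centres from the origin matters. The constant is the one from balls with \<open>2 R \<le> \<rho>\<close>: the density bound
  contributes \<open>4 * exp 2 * n / R\<close> and the integral over \<open>[\<rho> - R, \<rho> + R]\<close> contributes \<open>9 * 21 ^ m * R\<close>. Larger
  balls give the smaller constant \<open>(1 + 4 * exp 2) * 5 ^ m * (n / m)\<close>.
\<close>

lemma ball_integral_dimension_transfer:
  fixes f :: "real \<Rightarrow> ennreal" and K :: ennreal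
  assumes m: "1 \<le> m" "m \<le> n" and f [measurable]: "f \<in> borel_measurable borel"
    and \<rho>: "nrm m x' = \<rho>" "nrm n x = \<rho>" "0 < \<rho>"
    and K: "\<forall>R>0. (\<integral>\<^sup>+y\<in>ball_Rn m x' R. f (nrm m y) \<partial>Rn m) \<le> K * ennreal (vol1 m * R ^ m)"
    and R: "0 < R"
  shows "(\<integral>\<^sup>+y\<in>ball_Rn n x R. f (nrm n y) \<partial>Rn n)
       \<le> ennreal (36 * exp 2 * m * 21 ^ m * (n / m)) * K * ennreal (vol1 n * R ^ n)"
proof -
  have n: "1 \<le> n" using m by simp
  have vn: "0 < vol1 n" "0 < vol1 m" by simp_all
  then have vm: "vol1 m \<noteq> 0" by (intro less_imp_neq[THEN not_sym])
  have near: "\<rho> - R \<le> nrm n y \<and> nrm n y \<le> \<rho> + R" if "y \<in> ball_Rn n x R" for y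
    using nrm_in_ball[OF that] \<rho> by auto
  note vol = emeasure_ball_Rn[OF n R, of x]
  show ?thesis
  proof (cases "2 * R \<le> \<rho>")
    case True
    \<comment> \<open>A ball away from the origin: the density bound with \<open>\<epsilon> = R / (n \<rho>)\<close> and \<open>a = \<rho> / 2\<close>.\<close>
    let ?g = "\<lambda>t. f t * indicator {\<rho> - R..\<rho> + R} t"
    define G where "G = (\<integral>\<^sup>+t. ?g t \<partial>lborel)"
    have "ennreal (vol1 m * R ^ m) * G
        \<le> ennreal (9 * 3 ^ m * R) * (\<integral>\<^sup>+y\<in>ball_Rn m x' (7 * R). f (nrm m y) \<partial>Rn m)"
      using interval_integral_le_ball_integral[OF m(1) f R, of x'] True \<rho> emeasure_ball_Rn[OF m(1) R, of x']
      by (simp add: G_def)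
    also have "\<dots> \<le> ennreal (9 * 3 ^ m * R) * (K * ennreal (vol1 m * (7 * R) ^ m))"
      using R by (intro mult_left_mono K[rule_format]) auto
    finally have "G \<le> ennreal (1 / (vol1 m * R ^ m)) * (ennreal (9 * 3 ^ m * R) * (K * ennreal (vol1 m * (7 * R) ^ m)))"
      using R vn by (intro ennreal_cmult_le_imp_le) auto
    also have "\<dots> = ennreal (1 / (vol1 m * R ^ m)) * ennreal (9 * 3 ^ m * R) * ennreal (vol1 m * (7 * R) ^ m) * K"
      by (simp add: ac_simps)
    also have "ennreal (1 / (vol1 m * R ^ m)) * ennreal (9 * 3 ^ m * R) * ennreal (vol1 m * (7 * R) ^ m)
        = ennreal (1 / (vol1 m * R ^ m) * (9 * 3 ^ m * R) * (vol1 m * (7 * R) ^ m))"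
      using R vn by (simp add: ennreal_mult[symmetric] del: times_divide_eq_left)
    also have "1 / (vol1 m * R ^ m) * (9 * 3 ^ m * R) * (vol1 m * (7 * R) ^ m) = 9 * (3 ^ m * 7 ^ m) * R"
      using R vm by (simp add: power_mult_distrib)
    also have "(3::real) ^ m * 7 ^ m = 21 ^ m"
      by (simp flip: power_mult_distrib)
    finally have G: "G \<le> ennreal (9 * 21 ^ m * R) * K" .
    have "(\<integral>\<^sup>+y\<in>ball_Rn n x R. f (nrm n y) \<partial>Rn n) = (\<integral>\<^sup>+y\<in>ball_Rn n x R. ?g (nrm n y) \<partial>Rn n)"
      using near by (intro nn_integral_cong) (auto split: split_indicator)
    also have "\<dots> \<le> ennreal (2 * exp 2 / (R / (n * \<rho>) * (\<rho> / 2))) * emeasure (Rn n) (ball_Rn n x R) * G"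
      unfolding G_def
    proof (rule ball_integral_le_radial_integral[OF n _ R])
      show "?g t = 0" if "t < \<rho> / 2" for t using that True by auto
    qed (use R \<rho> n True in auto)
    also have "2 * exp 2 / (R / (n * \<rho>) * (\<rho> / 2)) = 4 * exp 2 * n / R"
      using R \<rho> n by (simp add: field_simps)
    also have "ennreal (4 * exp 2 * n / R) * emeasure (Rn n) (ball_Rn n x R) * G
        \<le> ennreal (4 * exp 2 * n / R) * emeasure (Rn n) (ball_Rn n x R) * (ennreal (9 * 21 ^ m * R) * K)"
      using G by (intro mult_left_mono) auto
    also have "\<dots> = (ennreal (4 * exp 2 * n / R) * ennreal (9 * 21 ^ m * R)) * K * ennreal (vol1 n * R ^ n)"
      unfolding vol by (simp add: ac_simps)
    also have "ennreal (4 * exp 2 * n / R) * ennreal (9 * 21 ^ m * R) = ennreal (4 * exp 2 * n / R * (9 * 21 ^ m * R))"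
      using R by (intro ennreal_mult[symmetric]) auto
    also have "4 * exp 2 * n / R * (9 * 21 ^ m * R) = 36 * exp 2 * m * 21 ^ m * (n / m)"
      using R m by simp
    finally show ?thesis .
  next
    case False
    \<comment> \<open>A ball that may contain the origin. Radii below \<open>R\<close> are treated in polar coordinates, where
      \<open>t ^ (n - 1) \<le> R ^ (n - m) * t ^ (m - 1)\<close>; from \<open>R\<close> on, the density bound applies with
      \<open>\<epsilon> = 1 / (2 n)\<close> and \<open>a = R\<close>, and \<open>1 \<le> (t / R) ^ (m - 1)\<close>.\<close>
    define G where "G = (\<integral>\<^sup>+t\<in>{0..3 * R}. f t * ennreal (t ^ (m - 1)) \<partial>lborel)"
    let ?f1 = "\<lambda>t. f t * indicator {0..<R} t" and ?f2 = "\<lambda>t. f t * indicator {R..3 * R} t"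
    have split: "(\<integral>\<^sup>+y\<in>ball_Rn n x R. f (nrm n y) \<partial>Rn n)
        \<le> (\<integral>\<^sup>+y. ?f1 (nrm n y) \<partial>Rn n) + (\<integral>\<^sup>+y\<in>ball_Rn n x R. ?f2 (nrm n y) \<partial>Rn n)"
    proof -
      have "f (nrm n y) * indicator (ball_Rn n x R) y
         \<le> ?f1 (nrm n y) + ?f2 (nrm n y) * indicator (ball_Rn n x R) y" for y
        using near[of y] False by (auto split: split_indicator)
      then have "(\<integral>\<^sup>+y\<in>ball_Rn n x R. f (nrm n y) \<partial>Rn n)
         \<le> (\<integral>\<^sup>+y. ?f1 (nrm n y) + ?f2 (nrm n y) * indicator (ball_Rn n x R) y \<partial>Rn n)"
        by (intro nn_integral_mono)
      then show ?thesis by (subst (asm) nn_integral_add) auto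
    qed
    have part1: "(\<integral>\<^sup>+y. ?f1 (nrm n y) \<partial>Rn n) \<le> ennreal (n / R ^ m) * ennreal (vol1 n * R ^ n) * G"
    proof -
      have "(\<integral>\<^sup>+y. ?f1 (nrm n y) \<partial>Rn n)
          = ennreal (n * vol1 n) * (\<integral>\<^sup>+t\<in>{0..}. ?f1 t * ennreal (t ^ (n - 1)) \<partial>lborel)"
        by (rule nn_integral_nrm[OF n]) simp
      also have "(\<integral>\<^sup>+t\<in>{0..}. ?f1 t * ennreal (t ^ (n - 1)) \<partial>lborel)
          \<le> (\<integral>\<^sup>+t. ennreal (R ^ (n - m)) * (f t * ennreal (t ^ (m - 1)) * indicator {0..3 * R} t) \<partial>lborel)"
      proof (intro nn_integral_mono)
        fix t
        have "t ^ (n - 1) \<le> R ^ (n - m) * t ^ (m - 1)" if "0 \<le> t" "t < R"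
        proof -
          have "t ^ (n - 1) = t ^ (n - m) * t ^ (m - 1)"
            using m by (simp add: power_add[symmetric])
          also have "\<dots> \<le> R ^ (n - m) * t ^ (m - 1)"
            using that by (intro mult_right_mono power_mono) auto
          finally show ?thesis .
        qed
        then have "ennreal (t ^ (n - 1)) \<le> ennreal (R ^ (n - m)) * ennreal (t ^ (m - 1))" if "0 \<le> t" "t < R"
          using that R by (simp add: ennreal_mult[symmetric] ennreal_leI)
        then have "f t * ennreal (t ^ (n - 1)) \<le> f t * (ennreal (R ^ (n - m)) * ennreal (t ^ (m - 1)))" if "0 \<le> t" "t < R"
          using that by (intro mult_left_mono) auto
        then show "?f1 t * ennreal (t ^ (n - 1)) * indicator {0..} t
            \<le> ennreal (R ^ (n - m)) * (f t * ennreal (t ^ (m - 1)) * indicator {0..3 * R} t)"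
          using R by (auto simp: ac_simps split: split_indicator)
      qed
      also have "\<dots> = ennreal (R ^ (n - m)) * G"
        unfolding G_def by (rule nn_integral_cmult) simp
      finally have "(\<integral>\<^sup>+y. ?f1 (nrm n y) \<partial>Rn n) \<le> ennreal (n * vol1 n) * (ennreal (R ^ (n - m)) * G)"
        by (simp add: mult_left_mono)
      also have "\<dots> = ennreal (n * vol1 n * R ^ (n - m)) * G"
        using R vn by (simp add: ennreal_mult mult.assoc)
      also have "n * vol1 n * R ^ (n - m) = n / R ^ m * (vol1 n * R ^ n)"
        using R m by (simp add: power_diff)
      also have "ennreal (n / R ^ m * (vol1 n * R ^ n)) = ennreal (n / R ^ m) * ennreal (vol1 n * R ^ n)"
        using R vn by (intro ennreal_mult) auto
      finally show ?thesis .
    qed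
    have part2: "(\<integral>\<^sup>+y\<in>ball_Rn n x R. ?f2 (nrm n y) \<partial>Rn n)
        \<le> ennreal (4 * exp 2 * n / R ^ m) * ennreal (vol1 n * R ^ n) * G"
    proof -
      have "(\<integral>\<^sup>+y\<in>ball_Rn n x R. ?f2 (nrm n y) \<partial>Rn n)
          \<le> ennreal (2 * exp 2 / (1 / (2 * n) * R)) * emeasure (Rn n) (ball_Rn n x R) * (\<integral>\<^sup>+t. ?f2 t \<partial>lborel)"
        by (rule ball_integral_le_radial_integral[OF n _ R]) (use R \<rho> n False in auto)
      also have "2 * exp 2 / (1 / (2 * n) * R) = 4 * exp 2 * n / R"
        using R n by (simp add: field_simps)
      also have "(\<integral>\<^sup>+t. ?f2 t \<partial>lborel) \<le> ennreal (1 / R ^ (m - 1)) * G"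
      proof (rule ennreal_cmult_le_imp_le)
        have "ennreal (R ^ (m - 1)) * (\<integral>\<^sup>+t. ?f2 t \<partial>lborel) = (\<integral>\<^sup>+t. ennreal (R ^ (m - 1)) * ?f2 t \<partial>lborel)"
          by (rule nn_integral_cmult[symmetric]) simp
        also have "\<dots> \<le> G"
          unfolding G_def
        proof (intro nn_integral_mono)
          fix t
          have "ennreal (R ^ (m - 1)) \<le> ennreal (t ^ (m - 1))" if "R \<le> t"
            using that R by (intro ennreal_leI power_mono) auto
          then have "ennreal (R ^ (m - 1)) * f t \<le> ennreal (t ^ (m - 1)) * f t" if "R \<le> t"
            using that by (intro mult_right_mono) auto
          then show "ennreal (R ^ (m - 1)) * ?f2 t \<le> f t * ennreal (t ^ (m - 1)) * indicator {0..3 * R} t"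
            using R by (auto simp: ac_simps split: split_indicator)
        qed
        finally show "ennreal (R ^ (m - 1)) * (\<integral>\<^sup>+t. ?f2 t \<partial>lborel) \<le> G" .
      qed (use R in simp)
      finally have "(\<integral>\<^sup>+y\<in>ball_Rn n x R. ?f2 (nrm n y) \<partial>Rn n)
          \<le> ennreal (4 * exp 2 * n / R) * emeasure (Rn n) (ball_Rn n x R) * (ennreal (1 / R ^ (m - 1)) * G)"
        by (simp add: mult_left_mono)
      also have "\<dots> = ennreal (4 * exp 2 * n / R) * ennreal (1 / R ^ (m - 1)) * ennreal (vol1 n * R ^ n) * G"
        unfolding vol by (simp add: ac_simps)
      also have "ennreal (4 * exp 2 * n / R) * ennreal (1 / R ^ (m - 1)) = ennreal (4 * exp 2 * n / R * (1 / R ^ (m - 1)))"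
        using R by (intro ennreal_mult[symmetric]) auto
      also have "4 * exp 2 * n / R * (1 / R ^ (m - 1)) = 4 * exp 2 * n / R ^ m"
        using m by (cases m) auto
      finally show ?thesis .
    qed
    have G: "G \<le> ennreal (5 ^ m * R ^ m / m) * K"
    proof -
      have "G = (\<integral>\<^sup>+t\<in>{0..}. (f t * indicator {0..3 * R} t) * ennreal (t ^ (m - 1)) \<partial>lborel)"
        unfolding G_def by (intro nn_integral_cong) (auto split: split_indicator)
      then have "ennreal (m * vol1 m) * G = ennreal (m * vol1 m) *
          (\<integral>\<^sup>+t\<in>{0..}. (f t * indicator {0..3 * R} t) * ennreal (t ^ (m - 1)) \<partial>lborel)"
        by (rule arg_cong)
      also have "\<dots> = (\<integral>\<^sup>+y. f (nrm m y) * indicator {0..3 * R} (nrm m y) \<partial>Rn m)"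
        by (rule nn_integral_nrm[OF m(1), symmetric]) simp
      also have "\<dots> \<le> (\<integral>\<^sup>+y\<in>ball_Rn m x' (5 * R). f (nrm m y) \<partial>Rn m)"
      proof (rule nn_integral_mono)
        fix y assume y: "y \<in> space (Rn m)"
        have "y \<in> ball_Rn m x' (5 * R)" if "nrm m y \<le> 3 * R"
        proof -
          have "L2_set (\<lambda>i. y i - x' i) {..<m} \<le> nrm m y + L2_set (\<lambda>i. - x' i) {..<m}"
            using L2_set_triangle_ineq[of y "\<lambda>i. - x' i" "{..<m}"] by simp
          also have "L2_set (\<lambda>i. - x' i) {..<m} = \<rho>"
            using \<rho> by (simp add: L2_set_def)
          finally show ?thesis
            using that False y by (simp add: ball_Rn_def space_lebesgue_Rn)
        qed
        then show "f (nrm m y) * indicator {0..3 * R} (nrm m y) \<le> f (nrm m y) * indicator (ball_Rn m x' (5 * R)) y"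
          by (auto split: split_indicator)
      qed
      also have "\<dots> \<le> K * ennreal (vol1 m * (5 * R) ^ m)"
        using R by (intro K[rule_format]) auto
      finally have "G \<le> ennreal (1 / (m * vol1 m)) * (K * ennreal (vol1 m * (5 * R) ^ m))"
        using m vn by (intro ennreal_cmult_le_imp_le) auto
      also have "\<dots> = ennreal (1 / (m * vol1 m)) * ennreal (vol1 m * (5 * R) ^ m) * K"
        by (simp add: ac_simps)
      also have "ennreal (1 / (m * vol1 m)) * ennreal (vol1 m * (5 * R) ^ m)
          = ennreal (1 / (m * vol1 m) * (vol1 m * (5 * R) ^ m))"
        using R vn by (intro ennreal_mult[symmetric]) auto
      also have "1 / (m * vol1 m) * (vol1 m * (5 * R) ^ m) = 5 ^ m * R ^ m / m"
        using vm by (simp add: power_mult_distrib)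
      finally show ?thesis .
    qed
    have "(\<integral>\<^sup>+y\<in>ball_Rn n x R. f (nrm n y) \<partial>Rn n)
        \<le> ennreal (n / R ^ m) * ennreal (vol1 n * R ^ n) * G + ennreal (4 * exp 2 * n / R ^ m) * ennreal (vol1 n * R ^ n) * G"
      using split add_mono[OF part1 part2] by (rule order_trans)
    also have "\<dots> = (ennreal (n / R ^ m) + ennreal (4 * exp 2 * n / R ^ m)) * ennreal (vol1 n * R ^ n) * G"
      by (simp add: distrib_right)
    also have "ennreal (n / R ^ m) + ennreal (4 * exp 2 * n / R ^ m) = ennreal ((1 + 4 * exp 2) * n / R ^ m)"
      using R by (subst ennreal_plus[symmetric]) (auto simp: field_simps)
    also have "ennreal ((1 + 4 * exp 2) * n / R ^ m) * ennreal (vol1 n * R ^ n) * G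
        \<le> ennreal ((1 + 4 * exp 2) * n / R ^ m) * ennreal (vol1 n * R ^ n) * (ennreal (5 ^ m * R ^ m / m) * K)"
      using G by (intro mult_left_mono) auto
    also have "\<dots> = (ennreal ((1 + 4 * exp 2) * n / R ^ m) * ennreal (5 ^ m * R ^ m / m)) * K * ennreal (vol1 n * R ^ n)"
      by (simp add: ac_simps)
    also have "ennreal ((1 + 4 * exp 2) * n / R ^ m) * ennreal (5 ^ m * R ^ m / m)
        = ennreal ((1 + 4 * exp 2) * n / R ^ m * (5 ^ m * R ^ m / m))"
      using R by (intro ennreal_mult[symmetric]) (auto simp: add_nonneg_nonneg)
    also have "(1 + 4 * exp 2) * n / R ^ m * (5 ^ m * R ^ m / m) = (1 + 4 * exp 2) * 5 ^ m * (n / m)"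
      using R by simp
    also have "ennreal ((1 + 4 * exp 2) * 5 ^ m * (n / m)) * K * ennreal (vol1 n * R ^ n)
        \<le> ennreal (36 * exp 2 * m * 21 ^ m * (n / m)) * K * ennreal (vol1 n * R ^ n)"
    proof (intro mult_right_mono ennreal_leI)
      have "(1::real) \<le> exp 2" by simp
      then have "(1 + 4 * exp (2::real)) \<le> 36 * exp 2 * 1" by linarith
      also have "\<dots> \<le> 36 * exp 2 * real m" using m by (intro mult_left_mono) auto
      finally show "(1 + 4 * exp (2::real)) * 5 ^ m \<le> 36 * exp 2 * m * 21 ^ m"
        by (intro mult_mono power_mono) auto
    qed auto
    finally show ?thesis .
  qed
qed

text \<open>
  The exceptional sets live in different dimensions. They are matched through the radii: a radius is good
  if some point of \<open>\<real>\<^sup>m\<close> at that distance satisfies the maximal inequality, and almost every radius is.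
\<close>

lemma A1_bound_dimension_transfer:
  assumes m: "1 \<le> m" "m \<le> n" and w0: "\<forall>t\<ge>0. 0 \<le> w0 t"
    and h: "h \<in> borel_measurable borel" "AE t in lborel. 0 < t \<longrightarrow> w0 t = h t"
    and C: "0 < C" "A1_bound m (radial m w0) C"
  shows "A1_bound n (radial n w0) (36 * exp 2 * m * 21 ^ m * (n / m) * C)"
proof -
  let ?c = "36 * exp 2 * m * 21 ^ m * (n / m)"
  have n: "1 \<le> n" using m by simp
  define good where "good t \<longleftrightarrow>
    (\<exists>x. nrm m x = t \<and> maximal_op m (radial m w0) x \<le> ennreal C * ennreal (w0 t))" for t
  have "AE x in Rn m. good (nrm m x)"
    using C(2) unfolding A1_bound_def lebesgue_Rn_def AE_completion_iff
    by (rule eventually_mono) (auto simp: good_def radial_def)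
  then have "AE t in lborel. 0 < t \<longrightarrow> good t"
    by (rule AE_nrmD[OF m(1)])
  then have "AE x in Rn n. good (nrm n x)"
    by (rule AE_nrmI[OF n])
  then have "AE x in Rn n. maximal_op n (radial n w0) x \<le> ennreal (?c * C) * ennreal (radial n w0 x)"
    using AE_nrm_pos[OF n]
  proof eventually_elim
    case (elim x)
    obtain x' where x': "nrm m x' = nrm n x"
      "maximal_op m (radial m w0) x' \<le> ennreal C * ennreal (w0 (nrm n x))"
      using elim(1) by (auto simp: good_def)
    let ?K = "ennreal C * ennreal (w0 (nrm n x))"
    have f: "(\<lambda>t. ennreal (h t)) \<in> borel_measurable borel" using h(1) by measurable
    note K = x'(2)[unfolded maximal_op_radial_le_iff[OF m(1) w0 h(2)]]
    have "maximal_op n (radial n w0) x \<le> ennreal ?c * ?K"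
      unfolding maximal_op_radial_le_iff[OF n w0 h(2)]
      by (intro allI impI ball_integral_dimension_transfer[OF m f x'(1) refl elim(2) K])
    then show ?case
      using C by (simp add: ennreal_mult radial_def mult.assoc)
  qed
  then show ?thesis
    unfolding A1_bound_def lebesgue_Rn_def AE_completion_iff .
qed

text \<open>
  The maximal function is finite at a single point \<open>z\<close> at least, and every ball is contained in a ball
  around \<open>z\<close>.
\<close>

lemma A1_bound_imp_weight:
  assumes n: "1 \<le> n" and w0: "\<forall>t\<ge>0. 0 \<le> w0 t"
    and h: "h \<in> borel_measurable borel" "AE t in lborel. 0 < t \<longrightarrow> w0 t = h t"
    and C: "A1_bound n (radial n w0) C"
  shows "weight n (radial n w0)"
proof -
  have "AE x in Rn n. maximal_op n (radial n w0) x \<le> ennreal C * ennreal (radial n w0 x)"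
    using C unfolding A1_bound_def lebesgue_Rn_def AE_completion_iff .
  from AE_Rn_ex[OF n this] obtain z where
    z: "maximal_op n (radial n w0) z \<le> ennreal C * ennreal (radial n w0 z)" by blast
  have meas: "radial n w0 \<in> borel_measurable (lebesgue_Rn n)"
    by (rule radial_measurable[OF n h])
  have "set_integrable (lebesgue_Rn n) (ball_Rn n x R) (radial n w0)" if "0 < R" for x R
    unfolding set_integrable_def
  proof (rule integrableI_bounded)
    have B: "ball_Rn n x R \<in> sets (lebesgue_Rn n)" by (simp add: lebesgue_Rn_def)
    show "(\<lambda>y. indicator (ball_Rn n x R) y *\<^sub>R radial n w0 y) \<in> borel_measurable (lebesgue_Rn n)"
      using meas B by measurable
    let ?R = "R + L2_set (\<lambda>i. x i - z i) {..<n}"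
    have R: "0 < ?R" using that by (simp add: add_pos_nonneg)
    have "(\<integral>\<^sup>+y. ennreal (norm (indicator (ball_Rn n x R) y *\<^sub>R radial n w0 y)) \<partial>lebesgue_Rn n)
        \<le> (\<integral>\<^sup>+y. ennreal \<bar>radial n w0 y\<bar> * indicator (ball_Rn n z ?R) y \<partial>lebesgue_Rn n)"
      using ball_Rn_mono[of R x z n ?R] by (intro nn_integral_mono) (auto split: split_indicator)
    also have "\<dots> = (\<integral>\<^sup>+y\<in>ball_Rn n z ?R. ennreal (h (nrm n y)) \<partial>Rn n)"
      by (rule nn_integral_abs_radial[OF n w0 h(2)])
    also have "\<dots> \<le> ennreal C * ennreal (radial n w0 z) * ennreal (vol1 n * ?R ^ n)"
      using z[unfolded maximal_op_radial_le_iff[OF n w0 h(2)]] R by blast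
    also have "\<dots> < \<infinity>" by (simp add: ennreal_mult_less_top)
    finally show "(\<integral>\<^sup>+y. ennreal (norm (indicator (ball_Rn n x R) y *\<^sub>R radial n w0 y)) \<partial>lebesgue_Rn n) < \<infinity>" .
  qed
  then show ?thesis
    using w0 by (auto simp: weight_def locally_integrable_Rn_def radial_def)
qed

section \<open>The constants over intervals\<close>

text \<open>
  An interval is determined up to its endpoints by \<open>a = Inf I\<close> and \<open>b = Sup I\<close>, so the masses are those of
  \<open>[a, b]\<close>, and comparing the powers of \<open>t\<close> at the right endpoint suffices.
\<close>

lemma radial_A1_bound_dimension_transfer:
  assumes m: "1 \<le> m" "m \<le> n" and w0: "\<forall>t\<ge>0. 0 \<le> w0 t"
    and h: "h \<in> borel_measurable borel" "AE t in lborel. 0 < t \<longrightarrow> w0 t = h t"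
    and C: "0 < C" "radial_A1_bound m w0 C"
  shows "radial_A1_bound n w0 (n / m * C)"
  unfolding radial_A1_bound_def
proof safe
  fix I :: "real set"
  assume I: "is_interval I" "bounded I" "I \<subseteq> {0..}" "0 < measure lebesgue I"
  have n: "1 \<le> n" using m by simp
  define a b where "a = Inf I" and "b = Sup I"
  have ne: "I \<noteq> {}" using I(4) by auto
  have bdd: "bdd_above I" "bdd_below I"
    using I(2) by (auto intro: bounded_imp_bdd_above bounded_imp_bdd_below)
  have sub: "I \<subseteq> {a..b}"
    using bdd by (auto simp: a_def b_def cInf_lower cSup_upper)
  have sup: "{a<..<b} \<subseteq> I"
  proof
    fix t assume t: "t \<in> {a<..<b}"
    then obtain p q where "p \<in> I" "p < t" "q \<in> I" "t < q"
      using bdd ne by (auto simp: a_def b_def cInf_less_iff less_cSup_iff)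
    then show "t \<in> I" using I(1) by (meson is_interval_1 less_imp_le)
  qed
  have a0: "0 \<le> a" using I(3) ne by (auto simp: a_def intro!: cInf_greatest)
  have ab: "a < b"
  proof (rule ccontr)
    assume "\<not> a < b"
    then have "I \<subseteq> {a}" using sub by auto
    then have "measure lebesgue I = 0"
      by (metis measure_empty negligible_sing negligible_subset negligible_imp_measure0)
    then show False using I(4) by simp
  qed
  have mass: "radial_mass k f I = (\<integral>\<^sup>+t\<in>{a..b}. ennreal (g t * t ^ (k - 1)) \<partial>lborel)"
    if "AE t in lborel. 0 < t \<longrightarrow> f t = g t" for k and f g :: "real \<Rightarrow> real"
    unfolding radial_mass_def nn_integral_completion
  proof (rule nn_integral_cong_AE)
    show "AE t in lborel. ennreal (f t * t ^ (k - 1)) * indicator I t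
        = ennreal (g t * t ^ (k - 1)) * indicator {a..b} t"
      using that AE_lborel_singleton[of a] AE_lborel_singleton[of b]
    proof eventually_elim
      case (elim t)
      show ?case
      proof (cases "t \<in> {a<..<b}")
        case True
        then show ?thesis using elim sup a0 by (auto simp: subset_eq)
      next
        case False
        then have "t \<notin> I" "t \<notin> {a..b}" using elim sub by auto
        then show ?thesis by simp
      qed
    qed
  qed
  have vol: "radial_mass k (\<lambda>_. 1) I = ennreal ((b ^ k - a ^ k) / k)" if "1 \<le> k" for k
    using mass[of "\<lambda>_. 1" "\<lambda>_. 1" k] nn_integral_power_Icc[OF that a0, of b] ab by simp
  have pos: "0 < (b ^ k - a ^ k) / k" if "1 \<le> k" for k :: nat
    using that a0 ab by (simp add: power_strict_mono)
  let ?E = "ess_inf_on I w0"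
  have "radial_mass n w0 I \<le> ennreal (b ^ (n - m)) * radial_mass m w0 I"
  proof -
    have "radial_mass n w0 I = (\<integral>\<^sup>+t\<in>{a..b}. ennreal (h t * t ^ (n - 1)) \<partial>lborel)"
      by (rule mass[OF h(2)])
    also have "\<dots> \<le> (\<integral>\<^sup>+t. ennreal (b ^ (n - m)) * (ennreal (h t * t ^ (m - 1)) * indicator {a..b} t) \<partial>lborel)"
    proof (rule nn_integral_mono_AE)
      show "AE t in lborel. ennreal (h t * t ^ (n - 1)) * indicator {a..b} t
          \<le> ennreal (b ^ (n - m)) * (ennreal (h t * t ^ (m - 1)) * indicator {a..b} t)"
        using h(2) AE_lborel_singleton[of 0]
      proof eventually_elim
        case (elim t)
        have "ennreal (h t * t ^ (n - 1)) \<le> ennreal (b ^ (n - m)) * ennreal (h t * t ^ (m - 1))" if "t \<in> {a..b}"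
        proof -
          have t: "0 < t" "t \<le> b" using that elim a0 by auto
          then have ht: "0 \<le> h t" using elim w0[rule_format, of t] by simp
          have "t ^ (n - 1) = t ^ (n - m) * t ^ (m - 1)"
            using m by (simp add: power_add[symmetric])
          then have "h t * t ^ (n - 1) = t ^ (n - m) * (h t * t ^ (m - 1))" by simp
          also have "\<dots> \<le> b ^ (n - m) * (h t * t ^ (m - 1))"
            using t ht by (intro mult_right_mono power_mono) auto
          finally show ?thesis
            using t ht by (simp add: ennreal_mult[symmetric] ennreal_leI)
        qed
        then show ?case by (auto split: split_indicator)
      qed
    qed
    also have "\<dots> = ennreal (b ^ (n - m)) * (\<integral>\<^sup>+t\<in>{a..b}. ennreal (h t * t ^ (m - 1)) \<partial>lborel)"
      using h(1) by (intro nn_integral_cmult) simp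
    also have "(\<integral>\<^sup>+t\<in>{a..b}. ennreal (h t * t ^ (m - 1)) \<partial>lborel) = radial_mass m w0 I"
      by (rule mass[OF h(2), symmetric])
    finally show ?thesis .
  qed
  also have "radial_mass m w0 I \<le> ennreal C * ?E * ennreal ((b ^ m - a ^ m) / m)"
  proof -
    have "radial_mass m w0 I / ennreal ((b ^ m - a ^ m) / m) \<le> ennreal C * ?E"
      using C(2) I vol[OF m(1)] unfolding radial_A1_bound_def by metis
    then show ?thesis using ennreal_divide_le_iff[OF pos[OF m(1)]] by blast
  qed
  also have "ennreal (b ^ (n - m)) * (ennreal C * ?E * ennreal ((b ^ m - a ^ m) / m))
      = (ennreal (b ^ (n - m)) * ennreal ((b ^ m - a ^ m) / m)) * (ennreal C * ?E)"
    by (simp add: ac_simps)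
  also have "ennreal (b ^ (n - m)) * ennreal ((b ^ m - a ^ m) / m) = ennreal (b ^ (n - m) * ((b ^ m - a ^ m) / m))"
    using a0 ab pos[OF m(1)] by (intro ennreal_mult[symmetric]) auto
  also have "\<dots> \<le> ennreal (n / m * ((b ^ n - a ^ n) / n))"
  proof (rule ennreal_leI)
    have "b ^ (n - m) * (b ^ m - a ^ m) = b ^ n - b ^ (n - m) * a ^ m"
      using m by (simp add: right_diff_distrib power_add[symmetric])
    also have "\<dots> \<le> b ^ n - a ^ (n - m) * a ^ m"
      using a0 ab by (intro diff_left_mono mult_right_mono power_mono) auto
    also have "\<dots> = b ^ n - a ^ n" using m by (simp add: power_add[symmetric])
    finally have "b ^ (n - m) * (b ^ m - a ^ m) \<le> b ^ n - a ^ n" .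
    then show "b ^ (n - m) * ((b ^ m - a ^ m) / m) \<le> n / m * ((b ^ n - a ^ n) / n)"
      using m n by (simp add: divide_right_mono)
  qed
  also have "ennreal (n / m * ((b ^ n - a ^ n) / n)) = ennreal (n / m) * ennreal ((b ^ n - a ^ n) / n)"
    using pos[OF n] by (intro ennreal_mult) auto
  also have "ennreal (n / m) * ennreal ((b ^ n - a ^ n) / n) * (ennreal C * ?E)
      = ennreal (n / m * C) * ?E * ennreal ((b ^ n - a ^ n) / n)"
  proof -
    have "ennreal (n / m * C) = ennreal (n / m) * ennreal C"
      using C by (intro ennreal_mult) auto
    then show ?thesis by (simp only: ac_simps)
  qed
  finally have "radial_mass n w0 I \<le> ennreal (n / m * C) * ?E * ennreal ((b ^ n - a ^ n) / n)"
    by (simp add: mult_left_mono mult_right_mono)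
  then show "radial_mass n w0 I / radial_mass n (\<lambda>_. 1) I \<le> ennreal (n / m * C) * ?E"
    unfolding vol[OF n] ennreal_divide_le_iff[OF pos[OF n]] .
qed

section \<open>Linear growth in the dimension\<close>

theorem lemma2p2:
  fixes m :: nat
  assumes "1 \<le> m"
  shows "\<exists>C>0. \<forall>w0 :: real \<Rightarrow> real.
           (\<forall>t\<ge>0. 0 \<le> w0 t) \<and> radial m w0 \<in> A1 m \<longrightarrow>
           (\<forall>n\<ge>m.
              radial n w0 \<in> A1 n \<and>
              A1_const n (radial n w0)
                \<le> ennreal (C * (real n / real m)) * A1_const m (radial m w0) \<and>
              radial_A1_const n w0
                \<le> ennreal (C * (real n / real m)) * radial_A1_const m w0)"
proof (intro exI[of _ "36 * exp 2 * real m * 21 ^ m"] conjI allI impI)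
  let ?c = "36 * exp 2 * real m * 21 ^ m"
  show "0 < ?c" using assms by simp
  fix w0 :: "real \<Rightarrow> real" and n :: nat
  assume w: "(\<forall>t\<ge>0. 0 \<le> w0 t) \<and> radial m w0 \<in> A1 m" and mn: "m \<le> n"
  then have n: "1 \<le> n" and w0: "\<forall>t\<ge>0. 0 \<le> w0 t" using assms by auto
  have cn: "0 < ?c * (real n / real m)" using assms n by simp
  have "radial m w0 \<in> borel_measurable (lebesgue_Rn m)"
    using w by (auto simp: A1_def weight_def intro: locally_integrable_Rn_imp_measurable)
  from radial_borel_representative[OF assms this] obtain h where
    h: "h \<in> borel_measurable borel" "AE t in lborel. 0 < t \<longrightarrow> w0 t = h t" by blast
  note transfer = A1_bound_dimension_transfer[OF assms mn w0 h]
  obtain C where C: "0 < C" "A1_bound m (radial m w0) C"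
    using w by (auto simp: A1_def)
  show "radial n w0 \<in> A1 n"
    using A1_bound_imp_weight[OF n w0 h transfer[OF C]] transfer[OF C] mult_pos_pos[OF cn C(1)]
    unfolding A1_def by blast
  show "A1_const n (radial n w0) \<le> ennreal (?c * (real n / real m)) * A1_const m (radial m w0)"
    unfolding A1_const_def by (rule Inf_ennreal_scale_le[OF cn]) (rule transfer)
  have "radial_A1_const n w0 \<le> ennreal (real n / real m) * radial_A1_const m w0"
    unfolding radial_A1_const_def
    by (rule Inf_ennreal_scale_le) (use assms n radial_A1_bound_dimension_transfer[OF assms mn w0 h] in auto)
  also have "\<dots> \<le> ennreal (?c * (real n / real m)) * radial_A1_const m w0"
  proof (intro mult_right_mono ennreal_leI)
    have "1 \<le> exp (2::real)" "1 \<le> real m" "1 \<le> (21::real) ^ m" using assms by auto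
    then have "1 * 1 * 1 * 1 \<le> ?c" by (intro mult_mono) auto
    then show "real n / real m \<le> ?c * (real n / real m)"
      using mult_right_mono[of 1 ?c "real n / real m"] by simp
  qed simp
  finally show "radial_A1_const n w0 \<le> ennreal (?c * (real n / real m)) * radial_A1_const m w0" .
qed

end
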